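(* Let $k$ be a field, $H$ a quantum commutative weak Hopf algebra over $k$ with antipode $S$, and $M$ a weak right $H$-Hopf module. Define $T:M\to M$ by $T(m)=m_{[0]}\cdot S(m_{[1]})$ for $m\in M$. Then $(M,\sqcap^L,T)$ is a Rota-Baxter paired (right) $H$-comodule of weight $-1$.
   Context: All spaces, maps and tensor products are over $k$; $\Delta(h)=h_1\otimes h_2$, and right coactions are written $\rho(m)=m_{[0]}\otimes m_{[1]}\in M\otimes H$. A weak bialgebra is a (unital) algebra and (counital) coalgebra $H$ such that: (1) $\Delta(xy)=\Delta(x)\Delta(y)$; (2) $\varepsilon(xyz)=\varepsilon(xy_1)\varepsilon(y_2z)=\varepsilon(xy_2)\varepsilon(y_1z)$ for all $x,y,z\in H$; (3) $(\Delta\otimes\mathrm{id})\Delta(1)=(\Delta(1)\otimes1)(1\otimes\Delta(1))=(1\otimes\Delta(1))(\Delta(1)\otimes1)$. Write $\Delta(1)=1_1\otimes1_2$. A weak Hopf algebra is a weak bialgebra with a linear map $S:H\to H$ such that $h_1S(h_2)=\varepsilon(1_1h)1_2$, $S(h_1)h_2=\varepsilon(h1_2)1_1$, $S(h_1)h_2S(h_3)=S(h)$ for all $h\in H$. Define $\sqcap^L(h)=\varepsilon(1_1h)1_2$ and $\sqcap^R(h)=\varepsilon(h1_2)1_1$. $H$ is quantum commutative if $h_1g\sqcap^R(h_2)=hg$ for all $h,g\in H$. A weak right $H$-Hopf module is a right $H$-module and right $H$-comodule $M$ such that $\rho(m\cdot h)=m_{[0]}\cdot h_1\otimes m_{[1]}h_2$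 for all $m\in M$, $h\in H$. For a right $H$-comodule $M$ with coaction $\rho$ and linear maps $P:H\to H$, $T:M\to M$, the triple $(M,P,T)$ is a Rota-Baxter paired (right) $H$-comodule of weight $\lambda\in k$ if $(T\otimes P)\rho=(\mathrm{id}\otimes P)\rho T+(T\otimes\mathrm{id})\rho T+\lambda\rho T$. *)

theory Defs
  imports Complex_Main "HOL-Library.Multiset"
begin

section \<open>Tensor products over a field\<close>

text \<open>
  A finite multiset of pairs stands for the formal sum of the corresponding pure tensors.
  The tensor product of two vector spaces is the quotient of the monoid of formal sums by
  the congruence generated by biadditivity, balancedness and \<open>0 \<otimes> y = 0\<close>.  The quotient is
  a group because \<open>(-x) \<otimes> y\<close> is inverse to \<open>x \<otimes> y\<close>, so this is the usual presentation;
  \<open>bilinear_rel_respects\<close> below is the existence half of its universal property (uniqueness is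
  immediate from generation by pure tensors).  Elements are congruence classes.
  Threefold tensor products are obtained in the same way from triples.
\<close>

inductive formal_cong :: "('g multiset \<Rightarrow> 'g multiset \<Rightarrow> bool) \<Rightarrow> 'g multiset \<Rightarrow> 'g multiset \<Rightarrow> bool"
  for R where
  base: "R p q \<Longrightarrow> formal_cong R p q"
| refl: "formal_cong R p p"
| sym: "formal_cong R p q \<Longrightarrow> formal_cong R q p"
| trans: "formal_cong R p q \<Longrightarrow> formal_cong R q r \<Longrightarrow> formal_cong R p r"
| add: "formal_cong R p q \<Longrightarrow> formal_cong R p' q' \<Longrightarrow> formal_cong R (p + p') (q + q')"

inductive bilinear_rel ::
    "('k::field \<Rightarrow> 'a::ab_group_add \<Rightarrow> 'a) \<Rightarrow> ('k \<Rightarrow> 'b::ab_group_add \<Rightarrow> 'b) \<Rightarrow>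
     ('a \<times> 'b) multiset \<Rightarrow> ('a \<times> 'b) multiset \<Rightarrow> bool"
  for s1 s2 where
  "bilinear_rel s1 s2 {#(x + x', y)#} {#(x, y), (x', y)#}"
| "bilinear_rel s1 s2 {#(x, y + y')#} {#(x, y), (x, y')#}"
| "bilinear_rel s1 s2 {#(s1 c x, y)#} {#(x, s2 c y)#}"
| "bilinear_rel s1 s2 {#(0, y)#} {#}"

inductive trilinear_rel ::
    "('k::field \<Rightarrow> 'a::ab_group_add \<Rightarrow> 'a) \<Rightarrow> ('k \<Rightarrow> 'b::ab_group_add \<Rightarrow> 'b) \<Rightarrow>
     ('k \<Rightarrow> 'c::ab_group_add \<Rightarrow> 'c) \<Rightarrow>
     ('a \<times> 'b \<times> 'c) multiset \<Rightarrow> ('a \<times> 'b \<times> 'c) multiset \<Rightarrow> bool"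
  for s1 s2 s3 where
  "trilinear_rel s1 s2 s3 {#(x + x', y, z)#} {#(x, y, z), (x', y, z)#}"
| "trilinear_rel s1 s2 s3 {#(x, y + y', z)#} {#(x, y, z), (x, y', z)#}"
| "trilinear_rel s1 s2 s3 {#(x, y, z + z')#} {#(x, y, z), (x, y, z')#}"
| "trilinear_rel s1 s2 s3 {#(s1 c x, y, z)#} {#(x, s2 c y, z)#}"
| "trilinear_rel s1 s2 s3 {#(x, s2 c y, z)#} {#(x, y, s3 c z)#}"
| "trilinear_rel s1 s2 s3 {#(0, y, z)#} {#}"

type_synonym ('a, 'b) tensor = "('a \<times> 'b) multiset set"
type_synonym ('a, 'b, 'c) tensor3 = "('a \<times> 'b \<times> 'c) multiset set"

definition tensor_class ::
    "('k::field \<Rightarrow> 'a::ab_group_add \<Rightarrow> 'a) \<Rightarrow> ('k \<Rightarrow> 'b::ab_group_add \<Rightarrow> 'b) \<Rightarrow>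
     ('a \<times> 'b) multiset \<Rightarrow> ('a, 'b) tensor" where
  "tensor_class s1 s2 p = {q. formal_cong (bilinear_rel s1 s2) p q}"

definition tensor3_class ::
    "('k::field \<Rightarrow> 'a::ab_group_add \<Rightarrow> 'a) \<Rightarrow> ('k \<Rightarrow> 'b::ab_group_add \<Rightarrow> 'b) \<Rightarrow>
     ('k \<Rightarrow> 'c::ab_group_add \<Rightarrow> 'c) \<Rightarrow> ('a \<times> 'b \<times> 'c) multiset \<Rightarrow> ('a, 'b, 'c) tensor3" where
  "tensor3_class s1 s2 s3 p = {q. formal_cong (trilinear_rel s1 s2 s3) p q}"

definition tensor_space ::
    "('k::field \<Rightarrow> 'a::ab_group_add \<Rightarrow> 'a) \<Rightarrow> ('k \<Rightarrow> 'b::ab_group_add \<Rightarrow> 'b) \<Rightarrow>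
     ('a, 'b) tensor set" where
  "tensor_space s1 s2 = range (tensor_class s1 s2)"

text \<open>
  Operations are lifted from representatives by unions over classes, as in
  \<open>HOL.Equiv_Relations\<close>; the lemmas below show independence of the representatives.
  In \<open>tensor_map\<close> and \<open>tensor_map2\<close> the scalings belong to the target.
\<close>

definition tensor_add ::
    "('k::field \<Rightarrow> 'a::ab_group_add \<Rightarrow> 'a) \<Rightarrow> ('k \<Rightarrow> 'b::ab_group_add \<Rightarrow> 'b) \<Rightarrow>
     ('a, 'b) tensor \<Rightarrow> ('a, 'b) tensor \<Rightarrow> ('a, 'b) tensor" where
  "tensor_add s1 s2 X Y = (\<Union>p\<in>X. \<Union>q\<in>Y. tensor_class s1 s2 (p + q))"

definition tensor_scale ::
    "('k::field \<Rightarrow> 'a::ab_group_add \<Rightarrow> 'a) \<Rightarrow> ('k \<Rightarrow> 'b::ab_group_add \<Rightarrow> 'b) \<Rightarrow>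
     'k \<Rightarrow> ('a, 'b) tensor \<Rightarrow> ('a, 'b) tensor" where
  "tensor_scale s1 s2 c X = (\<Union>p\<in>X. tensor_class s1 s2 {# (s1 c x, y). (x, y) \<in># p #})"

text \<open>\<open>f \<otimes> g\<close>, for linear \<open>f\<close> and \<open>g\<close>\<close>
definition tensor_map ::
    "('k::field \<Rightarrow> 'c::ab_group_add \<Rightarrow> 'c) \<Rightarrow> ('k \<Rightarrow> 'd::ab_group_add \<Rightarrow> 'd) \<Rightarrow>
     ('a \<Rightarrow> 'c) \<Rightarrow> ('b \<Rightarrow> 'd) \<Rightarrow> ('a, 'b) tensor \<Rightarrow> ('c, 'd) tensor" where
  "tensor_map s1 s2 f g X = (\<Union>p\<in>X. tensor_class s1 s2 {# (f x, g y). (x, y) \<in># p #})"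

text \<open>\<open>(x \<otimes> y, x' \<otimes> y') \<mapsto> f x x' \<otimes> g y y'\<close>, for bilinear \<open>f\<close> and \<open>g\<close>\<close>
definition tensor_map2 ::
    "('k::field \<Rightarrow> 'c::ab_group_add \<Rightarrow> 'c) \<Rightarrow> ('k \<Rightarrow> 'd::ab_group_add \<Rightarrow> 'd) \<Rightarrow>
     ('a \<Rightarrow> 'a' \<Rightarrow> 'c) \<Rightarrow> ('b \<Rightarrow> 'b' \<Rightarrow> 'd) \<Rightarrow> ('a, 'b) tensor \<Rightarrow> ('a', 'b') tensor \<Rightarrow> ('c, 'd) tensor"
  where
  "tensor_map2 s1 s2 f g X Y = (\<Union>p\<in>X. \<Union>q\<in>Y.
     tensor_class s1 s2 (\<Sum>(x, y)\<in>#p. {# (f x x', g y y'). (x', y') \<in># q #}))"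

text \<open>The linear map \<open>x \<otimes> y \<mapsto> f x y\<close> induced by a bilinear map \<open>f\<close>\<close>
definition tensor_lift :: "('a \<Rightarrow> 'b \<Rightarrow> 'c::comm_monoid_add) \<Rightarrow> ('a, 'b) tensor \<Rightarrow> 'c" where
  "tensor_lift f X = the_elem ((\<lambda>p. \<Sum>(x, y)\<in>#p. f x y) ` X)"

definition tensor3_lift ::
    "('a \<Rightarrow> 'b \<Rightarrow> 'c \<Rightarrow> 'd::comm_monoid_add) \<Rightarrow> ('a, 'b, 'c) tensor3 \<Rightarrow> 'd" where
  "tensor3_lift f X = the_elem ((\<lambda>p. \<Sum>(x, y, z)\<in>#p. f x y z) ` X)"

text \<open>
  \<open>D \<otimes> id\<close> and \<open>id \<otimes> D\<close> for a linear map \<open>D\<close> with values in a tensor product; \<open>d\<close> ranges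
  over the choices of a representative \<open>d x\<close> of each \<open>D x\<close>.
\<close>
definition tensor_map_left ::
    "('k::field \<Rightarrow> 'a::ab_group_add \<Rightarrow> 'a) \<Rightarrow> ('k \<Rightarrow> 'b::ab_group_add \<Rightarrow> 'b) \<Rightarrow>
     ('k \<Rightarrow> 'c::ab_group_add \<Rightarrow> 'c) \<Rightarrow>
     ('x \<Rightarrow> ('a, 'b) tensor) \<Rightarrow> ('x, 'c) tensor \<Rightarrow> ('a, 'b, 'c) tensor3" where
  "tensor_map_left s1 s2 s3 D X = (\<Union>p\<in>X. \<Union>d\<in>{d. \<forall>x. d x \<in> D x}.
     tensor3_class s1 s2 s3 (\<Sum>(x, z)\<in>#p. {# (a, b, z). (a, b) \<in># d x #}))"

definition tensor_map_right ::
    "('k::field \<Rightarrow> 'a::ab_group_add \<Rightarrow> 'a) \<Rightarrow> ('k \<Rightarrow> 'b::ab_group_add \<Rightarrow> 'b) \<Rightarrow>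
     ('k \<Rightarrow> 'c::ab_group_add \<Rightarrow> 'c) \<Rightarrow>
     ('x \<Rightarrow> ('b, 'c) tensor) \<Rightarrow> ('a, 'x) tensor \<Rightarrow> ('a, 'b, 'c) tensor3" where
  "tensor_map_right s1 s2 s3 D X = (\<Union>p\<in>X. \<Union>d\<in>{d. \<forall>x. d x \<in> D x}.
     tensor3_class s1 s2 s3 (\<Sum>(a, x)\<in>#p. {# (a, b, c). (b, c) \<in># d x #}))"

text \<open>\<open>X \<otimes> 1\<close> and \<open>1 \<otimes> X\<close>, and the product of the algebra \<open>H \<otimes> H \<otimes> H\<close>\<close>

definition tensor_one ::
    "('k::field \<Rightarrow> 'h::{ring,monoid_mult} \<Rightarrow> 'h) \<Rightarrow> ('h, 'h) tensor \<Rightarrow> ('h, 'h, 'h) tensor3" where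
  "tensor_one s X = (\<Union>p\<in>X. tensor3_class s s s {# (x, y, 1). (x, y) \<in># p #})"

definition one_tensor ::
    "('k::field \<Rightarrow> 'h::{ring,monoid_mult} \<Rightarrow> 'h) \<Rightarrow> ('h, 'h) tensor \<Rightarrow> ('h, 'h, 'h) tensor3" where
  "one_tensor s X = (\<Union>p\<in>X. tensor3_class s s s {# (1, x, y). (x, y) \<in># p #})"

definition tensor3_mult ::
    "('k::field \<Rightarrow> 'h::{ring,monoid_mult} \<Rightarrow> 'h) \<Rightarrow>
     ('h, 'h, 'h) tensor3 \<Rightarrow> ('h, 'h, 'h) tensor3 \<Rightarrow> ('h, 'h, 'h) tensor3" where
  "tensor3_mult s X Y = (\<Union>p\<in>X. \<Union>q\<in>Y.
     tensor3_class s s s (\<Sum>(x, y, z)\<in>#p. {# (x * x', y * y', z * z'). (x', y', z') \<in># q #}))"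

definition bilinear_map ::
    "('k::field \<Rightarrow> 'a::ab_group_add \<Rightarrow> 'a) \<Rightarrow> ('k \<Rightarrow> 'b::ab_group_add \<Rightarrow> 'b) \<Rightarrow>
     ('k \<Rightarrow> 'c::ab_group_add \<Rightarrow> 'c) \<Rightarrow> ('a \<Rightarrow> 'b \<Rightarrow> 'c) \<Rightarrow> bool" where
  "bilinear_map s1 s2 s3 f \<longleftrightarrow>
     (\<forall>x. Vector_Spaces.linear s2 s3 (f x)) \<and> (\<forall>y. Vector_Spaces.linear s1 s3 (\<lambda>x. f x y))"

definition tensor_linear ::
    "('k::field \<Rightarrow> 'v::ab_group_add \<Rightarrow> 'v) \<Rightarrow> ('k \<Rightarrow> 'a::ab_group_add \<Rightarrow> 'a) \<Rightarrow>
     ('k \<Rightarrow> 'b::ab_group_add \<Rightarrow> 'b) \<Rightarrow> ('v \<Rightarrow> ('a, 'b) tensor) \<Rightarrow> bool" where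
  "tensor_linear s s1 s2 D \<longleftrightarrow>
     (\<forall>v. D v \<in> tensor_space s1 s2) \<and>
     (\<forall>v w. D (v + w) = tensor_add s1 s2 (D v) (D w)) \<and>
     (\<forall>c v. D (s c v) = tensor_scale s1 s2 c (D v))"

subsection \<open>Well-definedness\<close>

lemma tensor_class_self: "p \<in> tensor_class s1 s2 p"
  by (simp add: tensor_class_def formal_cong.refl)

lemma tensor3_class_self: "p \<in> tensor3_class s1 s2 s3 p"
  by (simp add: tensor3_class_def formal_cong.refl)

lemma tensor_class_eq_iff:
  "tensor_class s1 s2 p = tensor_class s1 s2 q \<longleftrightarrow> formal_cong (bilinear_rel s1 s2) p q"
  unfolding tensor_class_def by (blast intro: formal_cong.refl formal_cong.sym formal_cong.trans)

lemma tensor3_class_eq_iff: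
  "tensor3_class s1 s2 s3 p = tensor3_class s1 s2 s3 q \<longleftrightarrow>
     formal_cong (trilinear_rel s1 s2 s3) p q"
  unfolding tensor3_class_def by (blast intro: formal_cong.refl formal_cong.sym formal_cong.trans)

lemma mem_tensor_class:
  "q \<in> tensor_class s1 s2 p \<longleftrightarrow> tensor_class s1 s2 q = tensor_class s1 s2 p"
  unfolding tensor_class_eq_iff by (auto simp: tensor_class_def intro: formal_cong.sym)

lemma formal_cong_respects:
  assumes "formal_cong R p q"
    and "\<And>p q. R p q \<Longrightarrow> F p = F q"
    and "\<And>p q. F (p + q) = F p + (F q :: 'c::ab_semigroup_add)"
  shows "F p = F q"
  using assms(1) by induction (simp_all add: assms(2,3))

lemma formal_cong_map:
  assumes "formal_cong R p q"
    and "\<And>p q. R p q \<Longrightarrow> formal_cong R' (F p) (F q)"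
    and "\<And>p q. F (p + q) = F p + F q"
  shows "formal_cong R' (F p) (F q)"
  using assms(1)
  by induction (auto simp: assms(2,3) intro: formal_cong.intros)

lemma formal_cong_sum:
  assumes "\<And>z. formal_cong R (G z) (G' z)"
  shows "formal_cong R (\<Sum>z\<in>#r. G z) (\<Sum>z\<in>#r. G' z)"
  using assms by (induction r) (auto intro: formal_cong.intros)

lemma sum_mset_add_mset:
  "(\<Sum>z\<in>#p. add_mset (h z) (k z)) = image_mset h p + (\<Sum>z\<in>#p. k z)"
  by (induction p) auto

lemma formal_cong_image:
  assumes "\<And>z. formal_cong R {#f z#} {#g z#}"
  shows "formal_cong R (image_mset f r) (image_mset g r)"
  using formal_cong_sum[of R "\<lambda>z. {#f z#}" "\<lambda>z. {#g z#}" r] assms by simp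

lemma formal_cong_image_add:
  assumes "\<And>z. formal_cong R {#f z#} {#g z, h z#}"
  shows "formal_cong R (image_mset f r) (image_mset g r + image_mset h r)"
proof -
  have "(\<Sum>z\<in>#r. {#g z, h z#}) = image_mset g r + image_mset h r"
    by (induction r) auto
  then show ?thesis
    using formal_cong_sum[of R "\<lambda>z. {#f z#}" "\<lambda>z. {#g z, h z#}" r] assms by simp
qed

lemma formal_cong_image_empty:
  assumes "\<And>z. formal_cong R {#f z#} {#}"
  shows "formal_cong R (image_mset f r) {#}"
  using formal_cong_sum[of R "\<lambda>z. {#f z#}" "\<lambda>z. {#}" r] assms by simp

lemma bilinear_rel_respects:
  assumes "bilinear_map s1 s2 s3 f" and "formal_cong (bilinear_rel s1 s2) p q"
  shows "(\<Sum>(x, y)\<in>#p. f x y) = (\<Sum>(x, y)\<in>#q. f x y)"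
proof (rule formal_cong_respects[OF assms(2)])
  have 1: "module_hom s2 s3 (f x)" and 2: "module_hom s1 s3 (\<lambda>x. f x y)" for x y
    using assms(1) by (auto simp: bilinear_map_def Vector_Spaces.linear_def)
  show "(\<Sum>(x, y)\<in>#p. f x y) = (\<Sum>(x, y)\<in>#q. f x y)" if "bilinear_rel s1 s2 p q" for p q
    using that
    by cases (simp_all add: module_hom.add[OF 1] module_hom.add[OF 2] module_hom.scale[OF 1]
        module_hom.scale[OF 2] module_hom.zero[OF 2])
qed simp

lemma tensor_lift_class:
  assumes "bilinear_map s1 s2 s3 f"
  shows "tensor_lift f (tensor_class s1 s2 p) = (\<Sum>(x, y)\<in>#p. f x y)"
proof -
  let ?F = "\<lambda>p. \<Sum>(x, y)\<in>#p. f x y"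
  have "?F q = ?F p" if "q \<in> tensor_class s1 s2 p" for q
  proof -
    have "formal_cong (bilinear_rel s1 s2) p q"
      using that by (simp add: tensor_class_def)
    then show ?thesis
      by (rule bilinear_rel_respects[OF assms, symmetric])
  qed
  then have "?F ` tensor_class s1 s2 p = {?F p}"
    using tensor_class_self[of p s1 s2] by blast
  then show ?thesis by (simp add: tensor_lift_def)
qed

lemma tensor_add_class:
  "tensor_add s1 s2 (tensor_class s1 s2 p) (tensor_class s1 s2 q) = tensor_class s1 s2 (p + q)"
proof -
  have "tensor_class s1 s2 (p' + q') = tensor_class s1 s2 (p + q)"
    if "p' \<in> tensor_class s1 s2 p" "q' \<in> tensor_class s1 s2 q" for p' q'
    using that unfolding mem_tensor_class tensor_class_eq_iff by (rule formal_cong.add)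
  then show ?thesis
    unfolding tensor_add_def using tensor_class_self[of p s1 s2] tensor_class_self[of q s1 s2] by blast
qed

lemma tensor_map_class:
  assumes f: "Vector_Spaces.linear s1 t1 f" and g: "Vector_Spaces.linear s2 t2 g"
  shows "tensor_map t1 t2 f g (tensor_class s1 s2 p) =
    tensor_class t1 t2 {# (f x, g y). (x, y) \<in># p #}"
proof -
  interpret f: Vector_Spaces.linear s1 t1 f by (fact f)
  interpret g: Vector_Spaces.linear s2 t2 g by (fact g)
  have "tensor_class t1 t2 {# (f x, g y). (x, y) \<in># p' #} =
      tensor_class t1 t2 {# (f x, g y). (x, y) \<in># p #}"
    if "p' \<in> tensor_class s1 s2 p" for p'
    using that unfolding mem_tensor_class tensor_class_eq_iff
  proof (rule formal_cong_map)
    show "formal_cong (bilinear_rel t1 t2) {# (f x, g y). (x, y) \<in># p #} {# (f x, g y). (x, y) \<in># q #}"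
      if "bilinear_rel s1 s2 p q" for p q
      using that
      by cases (auto simp: f.add g.add f.scale g.scale intro!: formal_cong.base bilinear_rel.intros)
  qed simp
  then show ?thesis
    unfolding tensor_map_def using tensor_class_self[of p s1 s2] by blast
qed

lemma tensor_scale_class:
  assumes "vector_space s1" "vector_space s2"
  shows "tensor_scale s1 s2 c (tensor_class s1 s2 p) =
    tensor_class s1 s2 {# (s1 c x, y). (x, y) \<in># p #}"
proof -
  interpret a: vector_space s1 by fact
  interpret b: vector_space s2 by fact
  have "Vector_Spaces.linear s2 s2 (\<lambda>x. x)"
    by (simp add: b.linear_ident)
  moreover have "Vector_Spaces.linear s1 s1 (s1 c)"
    by (simp add: a.linear_scale_self)
  ultimately show ?thesis
    using tensor_map_class[of s1 s1 "s1 c" s2 s2 "\<lambda>x. x" p]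
    by (simp add: tensor_scale_def tensor_map_def)
qed

lemma tensor_map2_class:
  assumes f: "bilinear_map s1 s1' t1 f" and g: "bilinear_map s2 s2' t2 g"
  shows "tensor_map2 t1 t2 f g (tensor_class s1 s2 p) (tensor_class s1' s2' q) =
    tensor_class t1 t2 (\<Sum>(x, y)\<in>#p. {# (f x x', g y y'). (x', y') \<in># q #})"
proof -
  let ?F = "\<lambda>p q. \<Sum>(x, y)\<in>#p. {# (f x x', g y y'). (x', y') \<in># q #}"
  let ?C = "formal_cong (bilinear_rel t1 t2)"
  have f1: "module_hom s1' t1 (f x)" and f2: "module_hom s1 t1 (\<lambda>x. f x x')" for x x'
    using f by (auto simp: bilinear_map_def Vector_Spaces.linear_def)
  have g1: "module_hom s2' t2 (g y)" and g2: "module_hom s2 t2 (\<lambda>y. g y y')" for y y'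
    using g by (auto simp: bilinear_map_def Vector_Spaces.linear_def)
  note hom = module_hom.add[OF f1] module_hom.add[OF f2] module_hom.add[OF g1] module_hom.add[OF g2]
    module_hom.scale[OF f1] module_hom.scale[OF f2] module_hom.scale[OF g1] module_hom.scale[OF g2]
    module_hom.zero[OF f1] module_hom.zero[OF f2]
  have F_add: "?F p (q + q') = ?F p q + ?F p q'" for p q q'
    by (induction p) (auto simp: ac_simps)
  have F_swap: "?F p q = (\<Sum>(x', y')\<in>#q. {# (f x x', g y y'). (x, y) \<in># p #})" for p q
  proof (induction q)
    case (add w q)
    then show ?case by (simp add: case_prod_unfold sum_mset_add_mset)
  qed (simp add: case_prod_unfold)
  have left: "?C (?F p q) (?F p' q)" if "bilinear_rel s1 s2 p p'" for p p' q
    unfolding F_swap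
    by (rule formal_cong_sum, use that in cases)
      (auto simp: hom intro!: formal_cong.base bilinear_rel.intros)
  have right: "?C (?F p q) (?F p q')" if "bilinear_rel s1' s2' q q'" for p q q'
    by (rule formal_cong_sum, use that in cases)
      (auto simp: hom intro!: formal_cong.base bilinear_rel.intros)
  have "tensor_class t1 t2 (?F p' q') = tensor_class t1 t2 (?F p q)"
    if "p' \<in> tensor_class s1 s2 p" "q' \<in> tensor_class s1' s2' q" for p' q'
    unfolding tensor_class_eq_iff
  proof (rule formal_cong.trans)
    show "?C (?F p' q') (?F p q')"
      using that(1) unfolding mem_tensor_class tensor_class_eq_iff
      by (rule formal_cong_map) (erule left, simp)
    show "?C (?F p q') (?F p q)"
      using that(2) unfolding mem_tensor_class tensor_class_eq_iff
      by (rule formal_cong_map) (erule right, rule F_add)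
  qed
  then show ?thesis
    unfolding tensor_map2_def
    using tensor_class_self[of p s1 s2] tensor_class_self[of q s1' s2'] by blast
qed

lemma trilinear_rel_respects:
  assumes f1: "\<And>y z. Vector_Spaces.linear s1 t (\<lambda>x. f x y z)"
    and f2: "\<And>x z. Vector_Spaces.linear s2 t (\<lambda>y. f x y z)"
    and f3: "\<And>x y. Vector_Spaces.linear s3 t (\<lambda>z. f x y z)"
    and cong: "formal_cong (trilinear_rel s1 s2 s3) p q"
  shows "(\<Sum>(x, y, z)\<in>#p. f x y z) = (\<Sum>(x, y, z)\<in>#q. f x y z)"
proof -
  have h1: "module_hom s1 t (\<lambda>x. f x y z)" and h2: "module_hom s2 t (\<lambda>y. f x y z)"
    and h3: "module_hom s3 t (\<lambda>z. f x y z)" for x y z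
    using f1 f2 f3 unfolding Vector_Spaces.linear_def by blast+
  have rel: "(\<Sum>(x, y, z)\<in>#p. f x y z) = (\<Sum>(x, y, z)\<in>#q. f x y z)"
    if "trilinear_rel s1 s2 s3 p q" for p q
    using that
  proof cases
    case (1 x x' y z)
    then show ?thesis by (simp add: module_hom.add[OF h1])
  next
    case (2 x y y' z)
    then show ?thesis by (simp add: module_hom.add[OF h2])
  next
    case (3 x y z z')
    then show ?thesis by (simp add: module_hom.add[OF h3])
  next
    case (4 c x y z)
    then show ?thesis by (simp add: module_hom.scale[OF h1] module_hom.scale[OF h2])
  next
    case (5 x c y z)
    then show ?thesis by (simp add: module_hom.scale[OF h2] module_hom.scale[OF h3])
  next
    case (6 y z)
    then show ?thesis by (simp add: module_hom.zero[OF h1])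
  qed
  show ?thesis
    by (rule formal_cong_respects[OF cong]) (erule rel, simp)
qed

lemma tensor3_lift_class:
  assumes "\<And>y z. Vector_Spaces.linear s1 t (\<lambda>x. f x y z)"
    and "\<And>x z. Vector_Spaces.linear s2 t (\<lambda>y. f x y z)"
    and "\<And>x y. Vector_Spaces.linear s3 t (\<lambda>z. f x y z)"
  shows "tensor3_lift f (tensor3_class s1 s2 s3 p) = (\<Sum>(x, y, z)\<in>#p. f x y z)"
proof -
  let ?F = "\<lambda>p. \<Sum>(x, y, z)\<in>#p. f x y z"
  have "?F q = ?F p" if "q \<in> tensor3_class s1 s2 s3 p" for q
  proof -
    have "formal_cong (trilinear_rel s1 s2 s3) p q"
      using that by (simp add: tensor3_class_def)
    then show ?thesis
      by (rule trilinear_rel_respects[where f = f, OF assms, symmetric])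
  qed
  then have "?F ` tensor3_class s1 s2 s3 p = {?F p}"
    using tensor3_class_self[of p s1 s2 s3] by blast
  then show ?thesis by (simp add: tensor3_lift_def)
qed

lemma trilinear_rel_zero_mid:
  assumes "vector_space s1" "vector_space s2"
  shows "formal_cong (trilinear_rel s1 s2 s3) {#(x, 0, z)#} {#}"
proof -
  interpret a: vector_space s1 by fact
  interpret b: vector_space s2 by fact
  have "formal_cong (trilinear_rel s1 s2 s3) {#(s1 0 x, 0, z)#} {#(x, s2 0 0, z)#}"
    by (intro formal_cong.base trilinear_rel.intros)
  moreover have "formal_cong (trilinear_rel s1 s2 s3) {#(0, 0, z)#} {#}"
    by (intro formal_cong.base trilinear_rel.intros)
  ultimately show ?thesis
    by (auto intro: formal_cong.sym formal_cong.trans)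
qed

lemma tensor_scale_transfer:
  "formal_cong (bilinear_rel s1 s2) {# (s1 c x, y). (x, y) \<in># p #} {# (x, s2 c y). (x, y) \<in># p #}"
  by (rule formal_cong_image) (auto intro!: formal_cong.base bilinear_rel.intros)

lemma tensor_linear_representatives:
  assumes vs: "vector_space s1" "vector_space s2"
    and D: "tensor_linear s s1 s2 D" and d: "\<And>x. D x = tensor_class s1 s2 (d x)"
  shows "formal_cong (bilinear_rel s1 s2) (d (x + y)) (d x + d y)"
    and "formal_cong (bilinear_rel s1 s2) (d (s c x)) {# (s1 c a, b). (a, b) \<in># d x #}"
    and "formal_cong (bilinear_rel s1 s2) (d 0) {#}"
proof -
  let ?B = "formal_cong (bilinear_rel s1 s2)"
  interpret a: vector_space s1 by (fact vs)
  show d_add: "?B (d (x + y)) (d x + d y)" for x y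
    using D unfolding tensor_linear_def d tensor_add_class tensor_class_eq_iff by blast
  show "?B (d (s c x)) {# (s1 c a, b). (a, b) \<in># d x #}"
    using D unfolding tensor_linear_def d tensor_scale_class[OF vs] tensor_class_eq_iff by blast
  let ?n = "{# (s1 (- 1) a, b). (a, b) \<in># d 0 #}"
  have "?B (image_mset (\<lambda>w. (fst w + s1 (- 1) (fst w), snd w)) (d 0))
      (image_mset (\<lambda>w. (fst w, snd w)) (d 0) + image_mset (\<lambda>w. (s1 (- 1) (fst w), snd w)) (d 0))"
    by (rule formal_cong_image_add) (intro formal_cong.base bilinear_rel.intros)
  moreover have "?B (image_mset (\<lambda>w. (fst w + s1 (- 1) (fst w), snd w)) (d 0)) {#}"
    by (rule formal_cong_image_empty) (auto intro: formal_cong.base bilinear_rel.intros)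
  ultimately have n: "?B (d 0 + ?n) {#}"
    by (auto simp: case_prod_unfold intro: formal_cong.sym formal_cong.trans)
  have "?B (d 0 + ?n) (d 0 + d 0 + ?n)"
    using formal_cong.add[OF d_add[of 0 0] formal_cong.refl] by simp
  moreover have "?B (d 0 + d 0 + ?n) (d 0)"
    using formal_cong.add[OF formal_cong.refl[of _ "d 0"] n] by (simp add: add.assoc)
  ultimately show "?B (d 0) {#}"
    using n by (blast intro: formal_cong.sym formal_cong.trans)
qed

lemma tensor_map_left_class:
  assumes vs: "vector_space s1" "vector_space s2"
    and D: "tensor_linear s s1 s2 D" and d: "\<And>x. D x = tensor_class s1 s2 (d x)"
  shows "tensor_map_left s1 s2 s3 D (tensor_class s s3 p) =
    tensor3_class s1 s2 s3 (\<Sum>(x, z)\<in>#p. {# (a, b, z). (a, b) \<in># d x #})"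
proof -
  let ?C = "formal_cong (trilinear_rel s1 s2 s3)"
  let ?j = "\<lambda>z q. {# (a, b, z). (a, b) \<in># q #}"
  let ?F = "\<lambda>d p. \<Sum>(x, z)\<in>#p. ?j z (d x)"
  note d_lin = tensor_linear_representatives[OF vs D d]
  have j: "?C (?j z q) (?j z q')" if "formal_cong (bilinear_rel s1 s2) q q'" for z q q'
    using that
  proof (rule formal_cong_map)
    show "?C (?j z q) (?j z q')" if "bilinear_rel s1 s2 q q'" for q q'
      using that by cases (auto intro!: formal_cong.base trilinear_rel.intros)
  qed simp
  have j_add: "?C (?j (z + z') q) (?j z q + ?j z' q)" for z z' q
    by (rule formal_cong_image_add) (auto intro!: formal_cong.base trilinear_rel.intros)
  have j_scale: "?C (?j z {# (a, s2 c b). (a, b) \<in># q #}) (?j (s3 c z) q)" for z c q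
    unfolding image_mset.compositionality
    by (rule formal_cong_image) (auto intro!: formal_cong.base trilinear_rel.intros)
  have rel: "?C (?F d p) (?F d q)" if "bilinear_rel s s3 p q" for p q
    using that
  proof cases
    case (1 x x' z)
    then show ?thesis using j[OF d_lin(1)[of x x'], of z] by simp
  next
    case (2 x z z')
    then show ?thesis using j_add[of z z' "d x"] by simp
  next
    case (3 c x z)
    from formal_cong.trans[OF j[OF formal_cong.trans[OF d_lin(2) tensor_scale_transfer]] j_scale] 3
    show ?thesis by simp
  next
    case (4 z)
    then show ?thesis using j[OF d_lin(3), of z] by simp
  qed
  have "tensor3_class s1 s2 s3 (?F d' p') = tensor3_class s1 s2 s3 (?F d p)"
    if "p' \<in> tensor_class s s3 p" "\<forall>x. d' x \<in> D x" for p' d'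
    unfolding tensor3_class_eq_iff
  proof (rule formal_cong.trans)
    show "?C (?F d' p') (?F d p')"
      using that(2)
      by (intro formal_cong_sum) (auto simp: d mem_tensor_class tensor_class_eq_iff intro: j)
    show "?C (?F d p') (?F d p)"
      using that(1) unfolding mem_tensor_class tensor_class_eq_iff
      by (rule formal_cong_map) (erule rel, simp)
  qed
  moreover have "\<forall>x. d x \<in> D x"
    by (simp add: d tensor_class_self)
  ultimately show ?thesis
    unfolding tensor_map_left_def using tensor_class_self[of p s s3] by blast
qed

lemma tensor_map_right_class:
  assumes vs: "vector_space s1" "vector_space s2" "vector_space s3"
    and D: "tensor_linear s s2 s3 D" and d: "\<And>x. D x = tensor_class s2 s3 (d x)"
  shows "tensor_map_right s1 s2 s3 D (tensor_class s1 s p) =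
    tensor3_class s1 s2 s3 (\<Sum>(a, x)\<in>#p. {# (a, b, c). (b, c) \<in># d x #})"
proof -
  let ?C = "formal_cong (trilinear_rel s1 s2 s3)"
  let ?j = "\<lambda>a q. {# (a, b, c). (b, c) \<in># q #}"
  let ?F = "\<lambda>d p. \<Sum>(a, x)\<in>#p. ?j a (d x)"
  note d_lin = tensor_linear_representatives[OF vs(2,3) D d]
  have j: "?C (?j a q) (?j a q')" if "formal_cong (bilinear_rel s2 s3) q q'" for a q q'
    using that
  proof (rule formal_cong_map)
    show "?C (?j a q) (?j a q')" if "bilinear_rel s2 s3 q q'" for q q'
      using that
      by cases (auto simp: trilinear_rel_zero_mid[OF vs(1,2)]
          intro!: formal_cong.base trilinear_rel.intros)
  qed simp
  have j_add: "?C (?j (a + a') q) (?j a q + ?j a' q)" for a a' q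
    by (rule formal_cong_image_add) (auto intro!: formal_cong.base trilinear_rel.intros)
  have j_scale: "?C (?j (s1 r a) q) (?j a {# (s2 r b, c). (b, c) \<in># q #})" for a r q
    unfolding image_mset.compositionality
    by (rule formal_cong_image) (auto intro!: formal_cong.base trilinear_rel.intros)
  have j_zero: "?C (?j 0 q) {#}" for q
    by (rule formal_cong_image_empty) (auto intro!: formal_cong.base trilinear_rel.intros)
  have rel: "?C (?F d p) (?F d q)" if "bilinear_rel s1 s p q" for p q
    using that
  proof cases
    case (1 x x' y)
    then show ?thesis using j_add[of x x' "d y"] by simp
  next
    case (2 x y y')
    then show ?thesis using j[OF d_lin(1)[of y y'], of x] by simp
  next
    case (3 c x y)
    from formal_cong.trans[OF j_scale formal_cong.sym[OF j[OF d_lin(2)]]] 3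
    show ?thesis by simp
  next
    case (4 y)
    then show ?thesis using j_zero[of "d y"] by simp
  qed
  have "tensor3_class s1 s2 s3 (?F d' p') = tensor3_class s1 s2 s3 (?F d p)"
    if "p' \<in> tensor_class s1 s p" "\<forall>x. d' x \<in> D x" for p' d'
    unfolding tensor3_class_eq_iff
  proof (rule formal_cong.trans)
    have dd: "formal_cong (bilinear_rel s2 s3) (d' x) (d x)" for x
      using that(2) by (simp add: d mem_tensor_class tensor_class_eq_iff)
    show "?C (?F d' p') (?F d p')"
      apply (rule formal_cong_sum)
      subgoal for z
        using j[OF dd[of "snd z"], of "fst z"] by (cases z) simp
      done
    show "?C (?F d p') (?F d p)"
      using that(1) unfolding mem_tensor_class tensor_class_eq_iff
      by (rule formal_cong_map) (erule rel, simp)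
  qed
  moreover have "\<forall>x. d x \<in> D x"
    by (simp add: d tensor_class_self)
  ultimately show ?thesis
    unfolding tensor_map_right_def using tensor_class_self[of p s1 s] by blast
qed

section \<open>Weak Hopf algebras and Hopf modules\<close>

text \<open>
  The sort \<open>{ring, monoid_mult}\<close> describes unital rings; \<open>ring_1\<close> would exclude the zero ring.
\<close>

locale unital_algebra = vector_space scale
  for scale :: "'k::field \<Rightarrow> 'h::{ring,monoid_mult} \<Rightarrow> 'h" +
  assumes scale_mult_left: "scale c x * y = scale c (x * y)"
    and scale_mult_right: "x * scale c y = scale c (x * y)"

begin

lemma tensor_one_class:
  "tensor_one scale (tensor_class scale scale p) =
     tensor3_class scale scale scale {# (x, y, 1). (x, y) \<in># p #}"
proof -
  have "tensor3_class scale scale scale {# (x, y, 1). (x, y) \<in># p' #} =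
      tensor3_class scale scale scale {# (x, y, 1). (x, y) \<in># p #}"
    if "p' \<in> tensor_class scale scale p" for p'
    using that unfolding mem_tensor_class tensor_class_eq_iff tensor3_class_eq_iff
  proof (rule formal_cong_map)
    show "formal_cong (trilinear_rel scale scale scale) {# (x, y, 1). (x, y) \<in># p #} {# (x, y, 1). (x, y) \<in># q #}"
      if "bilinear_rel scale scale p q" for p q
      using that by cases (auto intro!: formal_cong.base trilinear_rel.intros)
  qed simp
  then show ?thesis
    unfolding tensor_one_def using tensor_class_self[of p scale scale] by blast
qed

lemma one_tensor_class:
  "one_tensor scale (tensor_class scale scale p) =
     tensor3_class scale scale scale {# (1, x, y). (x, y) \<in># p #}"
proof -
  have "tensor3_class scale scale scale {# (1, x, y). (x, y) \<in># p' #} =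
      tensor3_class scale scale scale {# (1, x, y). (x, y) \<in># p #}"
    if "p' \<in> tensor_class scale scale p" for p'
    using that unfolding mem_tensor_class tensor_class_eq_iff tensor3_class_eq_iff
  proof (rule formal_cong_map)
    show "formal_cong (trilinear_rel scale scale scale) {# (1, x, y). (x, y) \<in># p #} {# (1, x, y). (x, y) \<in># q #}"
      if "bilinear_rel scale scale p q" for p q
      using that
      by cases (auto simp: trilinear_rel_zero_mid[OF vector_space_axioms vector_space_axioms]
          intro!: formal_cong.base trilinear_rel.intros)
  qed simp
  then show ?thesis
    unfolding one_tensor_def using tensor_class_self[of p scale scale] by blast
qed

lemma tensor3_mult_class:
  "tensor3_mult scale (tensor3_class scale scale scale p) (tensor3_class scale scale scale q) =
     tensor3_class scale scale scale
       (\<Sum>(x, y, z)\<in>#p. {# (x * x', y * y', z * z'). (x', y', z') \<in># q #})"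
proof -
  let ?F = "\<lambda>p q. \<Sum>(x, y, z)\<in>#p. {# (x * x', y * y', z * z'). (x', y', z') \<in># q #}"
  let ?C = "formal_cong (trilinear_rel scale scale scale)"
  have F_add: "?F p (q + q') = ?F p q + ?F p q'" for p q q'
    by (induction p) (auto simp: ac_simps)
  have F_swap: "?F p q = (\<Sum>(x', y', z')\<in>#q. {# (x * x', y * y', z * z'). (x, y, z) \<in># p #})" for p q
  proof (induction q)
    case (add w q)
    then show ?case by (simp add: case_prod_unfold sum_mset_add_mset)
  qed (simp add: case_prod_unfold)
  have left: "?C (?F p q) (?F p' q)" if "trilinear_rel scale scale scale p p'" for p p' q
    unfolding F_swap
    by (rule formal_cong_sum, use that in cases)
      (auto simp: distrib_right scale_mult_left intro!: formal_cong.base trilinear_rel.intros)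
  have right: "?C (?F p q) (?F p q')" if "trilinear_rel scale scale scale q q'" for p q q'
    by (rule formal_cong_sum, use that in cases)
      (auto simp: distrib_left scale_mult_right intro!: formal_cong.base trilinear_rel.intros)
  have "tensor3_class scale scale scale (?F p' q') = tensor3_class scale scale scale (?F p q)"
    if "p' \<in> tensor3_class scale scale scale p" "q' \<in> tensor3_class scale scale scale q" for p' q'
    unfolding tensor3_class_eq_iff
  proof (rule formal_cong.trans)
    have "?C p' p" "?C q' q"
      using that by (auto simp: tensor3_class_def intro: formal_cong.sym)
    show "?C (?F p' q') (?F p q')"
      using \<open>?C p' p\<close> by (rule formal_cong_map) (erule left, simp)
    show "?C (?F p q') (?F p q)"
      using \<open>?C q' q\<close> by (rule formal_cong_map) (erule right, rule F_add)
  qed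
  then show ?thesis
    unfolding tensor3_mult_def
    using tensor3_class_self[of p scale scale scale] tensor3_class_self[of q scale scale scale] by blast
qed

end

locale counital_coalgebra = vector_space scale
  for scale :: "'k::field \<Rightarrow> 'c::ab_group_add \<Rightarrow> 'c" +
  fixes \<Delta> :: "'c \<Rightarrow> ('c, 'c) tensor" and \<epsilon> :: "'c \<Rightarrow> 'k"
  assumes comult_linear: "tensor_linear scale scale scale \<Delta>"
    and counit_linear: "Vector_Spaces.linear scale (*) \<epsilon>"
    and coassoc: "tensor_map_left scale scale scale \<Delta> (\<Delta> x) =
                  tensor_map_right scale scale scale \<Delta> (\<Delta> x)"
    and counit_left: "tensor_lift (\<lambda>a b. scale (\<epsilon> a) b) (\<Delta> x) = x"
    and counit_right: "tensor_lift (\<lambda>a b. scale (\<epsilon> b) a) (\<Delta> x) = x"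

locale weak_bialgebra = unital_algebra scale + counital_coalgebra scale \<Delta> \<epsilon>
  for scale :: "'k::field \<Rightarrow> 'h::{ring,monoid_mult} \<Rightarrow> 'h"
    and \<Delta> :: "'h \<Rightarrow> ('h, 'h) tensor" and \<epsilon> :: "'h \<Rightarrow> 'k" +
  assumes comult_mult: "\<Delta> (x * y) = tensor_map2 scale scale (*) (*) (\<Delta> x) (\<Delta> y)"
    and counit_mult1: "\<epsilon> (x * y * z) = tensor_lift (\<lambda>y1 y2. \<epsilon> (x * y1) * \<epsilon> (y2 * z)) (\<Delta> y)"
    and counit_mult2: "\<epsilon> (x * y * z) = tensor_lift (\<lambda>y1 y2. \<epsilon> (x * y2) * \<epsilon> (y1 * z)) (\<Delta> y)"
    and comult_one1: "tensor_map_left scale scale scale \<Delta> (\<Delta> 1) =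
                      tensor3_mult scale (tensor_one scale (\<Delta> 1)) (one_tensor scale (\<Delta> 1))"
    and comult_one2: "tensor_map_left scale scale scale \<Delta> (\<Delta> 1) =
                      tensor3_mult scale (one_tensor scale (\<Delta> 1)) (tensor_one scale (\<Delta> 1))"

definition sqcap_L ::
    "('k::field \<Rightarrow> 'h::{ring,monoid_mult} \<Rightarrow> 'h) \<Rightarrow> ('h \<Rightarrow> ('h, 'h) tensor) \<Rightarrow> ('h \<Rightarrow> 'k) \<Rightarrow> 'h \<Rightarrow> 'h"
  where
  "sqcap_L scale \<Delta> \<epsilon> h = tensor_lift (\<lambda>a b. scale (\<epsilon> (a * h)) b) (\<Delta> 1)"

definition sqcap_R ::
    "('k::field \<Rightarrow> 'h::{ring,monoid_mult} \<Rightarrow> 'h) \<Rightarrow> ('h \<Rightarrow> ('h, 'h) tensor) \<Rightarrow> ('h \<Rightarrow> 'k) \<Rightarrow> 'h \<Rightarrow> 'h"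
  where
  "sqcap_R scale \<Delta> \<epsilon> h = tensor_lift (\<lambda>a b. scale (\<epsilon> (h * b)) a) (\<Delta> 1)"

locale weak_hopf_algebra = weak_bialgebra scale \<Delta> \<epsilon>
  for scale :: "'k::field \<Rightarrow> 'h::{ring,monoid_mult} \<Rightarrow> 'h"
    and \<Delta> :: "'h \<Rightarrow> ('h, 'h) tensor" and \<epsilon> :: "'h \<Rightarrow> 'k" +
  fixes S :: "'h \<Rightarrow> 'h"
  assumes antipode_linear: "Vector_Spaces.linear scale scale S"
    and antipode_right: "tensor_lift (\<lambda>h1 h2. h1 * S h2) (\<Delta> h) = sqcap_L scale \<Delta> \<epsilon> h"
    and antipode_left: "tensor_lift (\<lambda>h1 h2. S h1 * h2) (\<Delta> h) = sqcap_R scale \<Delta> \<epsilon> h"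
    and antipode_antipode:
      "tensor3_lift (\<lambda>h1 h2 h3. S h1 * h2 * S h3) (tensor_map_left scale scale scale \<Delta> (\<Delta> h)) = S h"

definition quantum_commutative ::
    "('k::field \<Rightarrow> 'h::{ring,monoid_mult} \<Rightarrow> 'h) \<Rightarrow> ('h \<Rightarrow> ('h, 'h) tensor) \<Rightarrow> ('h \<Rightarrow> 'k) \<Rightarrow> bool"
  where
  "quantum_commutative scale \<Delta> \<epsilon> \<longleftrightarrow>
     (\<forall>h g. tensor_lift (\<lambda>h1 h2. h1 * g * sqcap_R scale \<Delta> \<epsilon> h2) (\<Delta> h) = h * g)"

locale right_module = unital_algebra scaleH + M: vector_space scaleM
  for scaleH :: "'k::field \<Rightarrow> 'h::{ring,monoid_mult} \<Rightarrow> 'h"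
    and scaleM :: "'k \<Rightarrow> 'm::ab_group_add \<Rightarrow> 'm" +
  fixes act :: "'m \<Rightarrow> 'h \<Rightarrow> 'm"
  assumes act_bilinear: "bilinear_map scaleM scaleH scaleM act"
    and act_act: "act (act m g) h = act m (g * h)"
    and act_one: "act m 1 = m"

locale right_comodule = counital_coalgebra scaleH \<Delta> \<epsilon> + M: vector_space scaleM
  for scaleH :: "'k::field \<Rightarrow> 'h::ab_group_add \<Rightarrow> 'h"
    and \<Delta> :: "'h \<Rightarrow> ('h, 'h) tensor" and \<epsilon> :: "'h \<Rightarrow> 'k"
    and scaleM :: "'k \<Rightarrow> 'm::ab_group_add \<Rightarrow> 'm" +
  fixes \<rho> :: "'m \<Rightarrow> ('m, 'h) tensor"
  assumes coact_linear: "tensor_linear scaleM scaleM scaleH \<rho>"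
    and coact_coassoc: "tensor_map_left scaleM scaleH scaleH \<rho> (\<rho> m) =
                        tensor_map_right scaleM scaleH scaleH \<Delta> (\<rho> m)"
    and coact_counit: "tensor_lift (\<lambda>m0 m1. scaleM (\<epsilon> m1) m0) (\<rho> m) = m"

locale weak_right_hopf_module =
  weak_bialgebra scaleH \<Delta> \<epsilon> + right_module scaleH scaleM act + right_comodule scaleH \<Delta> \<epsilon> scaleM \<rho>
  for scaleH :: "'k::field \<Rightarrow> 'h::{ring,monoid_mult} \<Rightarrow> 'h"
    and \<Delta> :: "'h \<Rightarrow> ('h, 'h) tensor" and \<epsilon> :: "'h \<Rightarrow> 'k"
    and scaleM :: "'k \<Rightarrow> 'm::ab_group_add \<Rightarrow> 'm"
    and act :: "'m \<Rightarrow> 'h \<Rightarrow> 'm" and \<rho> :: "'m \<Rightarrow> ('m, 'h) tensor" +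
  assumes coact_act: "\<rho> (act m h) = tensor_map2 scaleM scaleH act (*) (\<rho> m) (\<Delta> h)"

locale rota_baxter_paired_comodule = right_comodule scaleH \<Delta> \<epsilon> scaleM \<rho>
  for scaleH :: "'k::field \<Rightarrow> 'h::ab_group_add \<Rightarrow> 'h"
    and \<Delta> :: "'h \<Rightarrow> ('h, 'h) tensor" and \<epsilon> :: "'h \<Rightarrow> 'k"
    and scaleM :: "'k \<Rightarrow> 'm::ab_group_add \<Rightarrow> 'm" and \<rho> :: "'m \<Rightarrow> ('m, 'h) tensor" +
  fixes P :: "'h \<Rightarrow> 'h" and T :: "'m \<Rightarrow> 'm" and wt :: 'k
  assumes P_linear: "Vector_Spaces.linear scaleH scaleH P"
    and T_linear: "Vector_Spaces.linear scaleM scaleM T"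
    and rota_baxter:
      "tensor_map scaleM scaleH T P (\<rho> m) =
         tensor_add scaleM scaleH
           (tensor_add scaleM scaleH
             (tensor_map scaleM scaleH id P (\<rho> (T m)))
             (tensor_map scaleM scaleH T id (\<rho> (T m))))
           (tensor_scale scaleM scaleH wt (\<rho> (T m)))"

end

theory Submission
  imports Defs
begin

text \<open>
  Write \<open>L = \<sqinter>\<^sup>L\<close>, \<open>R = \<sqinter>\<^sup>R\<close> and \<open>E\<close> for the map \<open>m \<mapsto> m\<^sub>0 \<cdot> S m\<^sub>1\<close>.  Since
  \<open>\<Delta> (S h) = \<Delta> 1 (S h\<^sub>2 \<otimes> S h\<^sub>1)\<close> and \<open>\<rho> m = \<rho> m \<Delta> 1\<close>, one gets
  \<open>\<rho> (E m) = m\<^sub>0 \<cdot> S m\<^sub>2 \<otimes> L m\<^sub>1\<close> and, as \<open>S\<close> reverses products, \<open>E (n \<cdot> S h) = n\<^sub>0 \<cdot> S (n\<^sub>1 R h)\<close>.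
  The first formula and \<open>L \<circ> L = L\<close> give \<open>(id \<otimes> L) \<rho> E = \<rho> E\<close>, so the Rota-Baxter identity of
  weight \<open>-1\<close> reduces to \<open>(E \<otimes> L) \<rho> = (E \<otimes> id) \<rho> E\<close>.  By both formulas the right-hand side is
  \<open>m\<^sub>0 \<cdot> S (m\<^sub>1 R m\<^sub>3) \<otimes> L m\<^sub>2 = m\<^sub>0 \<cdot> S (1\<^sub>1 m\<^sub>1 R m\<^sub>2) \<otimes> 1\<^sub>2 = m\<^sub>0 \<cdot> S (1\<^sub>1 m\<^sub>1) \<otimes> 1\<^sub>2 = m\<^sub>0 \<cdot> S m\<^sub>1 \<otimes> L m\<^sub>2\<close>,
  using \<open>h\<^sub>1 \<otimes> L h\<^sub>2 = 1\<^sub>1 h \<otimes> 1\<^sub>2\<close> and \<open>h\<^sub>1 R h\<^sub>2 = h\<close>.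

  Over a field, tensors are separated by contraction with linear functionals in the first factor;
  hence identities between tensors can be checked on Sweedler sums with values in vector spaces.
\<close>

section \<open>Separating tensors\<close>

lemma vector_space_field: "vector_space ((*) :: 'k::field \<Rightarrow> 'k \<Rightarrow> 'k)"
  by unfold_locales (simp_all add: algebra_simps)

declare formal_cong.trans [trans]

lemma formal_cong_sum_left:
  assumes "finite F"
  shows "formal_cong (bilinear_rel s1 s2) {#(\<Sum>b\<in>F. g b, y)#} {# (g b, y). b \<in># mset_set F #}"
  using assms
proof (induction rule: finite_induct)
  case empty
  show ?case by (simp add: formal_cong.base bilinear_rel.intros)
next
  case (insert b F)
  have "formal_cong (bilinear_rel s1 s2) {#(g b + sum g F, y)#} ({#(g b, y)#} + {#(sum g F, y)#})"
    using formal_cong.base[of "bilinear_rel s1 s2", OF bilinear_rel.intros(1)[of s1 s2 "g b" "sum g F" y]]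
    by (simp add: add_mset_commute)
  also have "formal_cong (bilinear_rel s1 s2) \<dots>
      ({#(g b, y)#} + {# (g b, y). b \<in># mset_set F #})"
    by (intro formal_cong.add formal_cong.refl insert.IH)
  finally show ?case using insert by simp
qed

text \<open>After a choice of basis of the first space, every formal sum is congruent to a normal
  form, a sum of \<open>b \<otimes> y_b\<close> over basis vectors \<open>b\<close>, where
  \<open>y_b\<close> is the contraction with the coordinate functional of \<open>b\<close>. Equal
  contractions therefore force equal normal forms.\<close>

lemma tensor_class_eqI:
  fixes s1 :: "'k::field \<Rightarrow> 'a::ab_group_add \<Rightarrow> 'a" and s2 :: "'k \<Rightarrow> 'b::ab_group_add \<Rightarrow> 'b"
  assumes "vector_space s1" "vector_space s2"
    and eq: "\<And>\<phi>. Vector_Spaces.linear s1 (*) \<phi> \<Longrightarrow>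
      (\<Sum>(x, y)\<in>#p. s2 (\<phi> x) y) = (\<Sum>(x, y)\<in>#q. s2 (\<phi> x) y)"
  shows "tensor_class s1 s2 p = tensor_class s1 s2 q"
proof -
  interpret a: vector_space s1 by fact
  interpret b: vector_space s2 by fact
  interpret k: vector_space "(*) :: 'k \<Rightarrow> 'k \<Rightarrow> 'k" by (rule vector_space_field)
  interpret ak: vector_space_pair s1 "(*)" ..
  let ?C = "formal_cong (bilinear_rel s1 s2)"
  define B where "B = a.extend_basis {}"
  have B: "a.independent B" "a.span B = UNIV"
    by (simp_all add: B_def a.independent_extend_basis a.span_extend_basis a.independent_empty)
  let ?R = "a.representation B"
  let ?c = "\<lambda>r b. \<Sum>(x, y)\<in>#r. s2 (?R x b) y"
  let ?N = "\<lambda>F r. {# (b, ?c r b). b \<in># mset_set F #}"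
  let ?supp = "\<lambda>r. \<Union>(x, y)\<in>set_mset r. {b. ?R x b \<noteq> 0}"
  \<comment> \<open>\<open>F\<close> may be any finite set containing the supports, so one
    \<open>F\<close> serves the whole induction and later both \<open>p\<close> and
    \<open>q\<close>.\<close>
  have normal: "?C r (?N F r)" if "finite F" "?supp r \<subseteq> F" for F r
    using that
  proof (induction r)
    case empty
    have "?C (?N F {#}) {#}"
    proof (rule formal_cong_image_empty)
      show "?C {#(b, \<Sum>(x, y)\<in>#{#}. s2 (?R x b) y)#} {#}" for b
      proof -
        \<comment> \<open>The generating relations kill a zero only in the left factor, so the zero
          on the right is written \<open>s2 0 0\<close> and its scalar is moved across.\<close>
        have "?C {#(b, s2 0 0)#} {#(s1 0 b, 0)#}"
          by (intro formal_cong.sym[OF formal_cong.base] bilinear_rel.intros)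
        also have "?C {#(s1 0 b, 0)#} {#}"
          unfolding a.scale_zero_left by (intro formal_cong.base bilinear_rel.intros)
        finally show ?thesis by simp
      qed
    qed
    then show ?case by (rule formal_cong.sym)
  next
    case (add w r)
    obtain x y where w: "w = (x, y)" by fastforce
    have x: "x = (\<Sum>b\<in>F. s1 (?R x b) b)"
    proof -
      have "x = (\<Sum>b | ?R x b \<noteq> 0. s1 (?R x b) b)"
        using a.sum_nonzero_representation_eq[OF B(1), of x] B(2) by simp
      also have "\<dots> = (\<Sum>b\<in>F. s1 (?R x b) b)"
        using add.prems by (intro sum.mono_neutral_left) (auto simp: w)
      finally show ?thesis .
    qed
    have "?C {#(x, y)#} {# (s1 (?R x b) b, y). b \<in># mset_set F #}"
      using formal_cong_sum_left[OF add.prems(1), of s1 s2 "\<lambda>b. s1 (?R x b) b" y] x by simp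
    also have "?C \<dots> {# (b, s2 (?R x b) y). b \<in># mset_set F #}"
      by (intro formal_cong_image formal_cong.base bilinear_rel.intros)
    finally have "?C ({#(x, y)#} + r) ({# (b, s2 (?R x b) y). b \<in># mset_set F #} + ?N F r)"
      by (rule formal_cong.add) (use add in simp)
    also have "?C \<dots> {# (b, s2 (?R x b) y + ?c r b). b \<in># mset_set F #}"
      by (intro formal_cong.sym[OF formal_cong_image_add] formal_cong.base bilinear_rel.intros)
    finally show ?case by (simp add: w)
  qed
  have coord: "?c p b = ?c q b" for b
    using B by (intro eq a.linear_representation)
  have "finite (?supp p \<union> ?supp q)"
    by (auto simp: a.finite_representation)
  note normal = normal[OF this]
  have "?C p (?N (?supp p \<union> ?supp q) p)"
    by (rule normal) simp
  also have "\<dots> = ?N (?supp p \<union> ?supp q) q"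
    by (simp only: coord)
  also have "?C \<dots> q"
    by (rule formal_cong.sym[OF normal]) simp
  finally show ?thesis
    unfolding tensor_class_eq_iff .
qed

section \<open>Sweedler sums\<close>

text \<open>
  Unlike \<open>tensor_lift\<close>, the sum over a chosen representative is additive in \<open>f\<close> without any
  bilinearity requirement, so that nested sums can be interchanged unconditionally.
\<close>
definition tsum :: "('a, 'b) tensor \<Rightarrow> ('a \<Rightarrow> 'b \<Rightarrow> 'c::comm_monoid_add) \<Rightarrow> 'c" where
  "tsum X f = (\<Sum>(x, y)\<in>#(SOME p. p \<in> X). f x y)"

lemma tensor_class_some:
  assumes "X \<in> tensor_space s1 s2"
  shows "tensor_class s1 s2 (SOME p. p \<in> X) = X"
  using assms mem_tensor_class[of _ s1 s2] tensor_class_self[of _ s1 s2]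
  unfolding tensor_space_def by (metis rangeE someI)

lemma tensor_lift_eq_tsum:
  assumes "X \<in> tensor_space s1 s2" "bilinear_map s1 s2 t f"
  shows "tensor_lift f X = tsum X f"
  using tensor_lift_class[OF assms(2), of "SOME p. p \<in> X"]
  by (simp add: tensor_class_some[OF assms(1)] tsum_def)

lemma tsum_class:
  assumes "bilinear_map s1 s2 t f"
  shows "tsum (tensor_class s1 s2 p) f = (\<Sum>(x, y)\<in>#p. f x y)"
  using tensor_lift_eq_tsum[OF _ assms] tensor_lift_class[OF assms]
  by (metis rangeI tensor_space_def)

lemma tsum_cong: "(\<And>x y. f x y = g x y) \<Longrightarrow> tsum X f = tsum X g"
  by (simp add: tsum_def)

lemma tsum_swap: "tsum X (\<lambda>x y. tsum Y (\<lambda>u v. f x y u v)) = tsum Y (\<lambda>u v. tsum X (\<lambda>x y. f x y u v))"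
  unfolding tsum_def case_prod_unfold by (rule sum_mset.swap)

lemma tsum_additive:
  assumes "g 0 = 0" "\<And>x y. g (x + y) = g x + g y"
  shows "g (tsum X f) = tsum X (\<lambda>x y. g (f x y))"
proof -
  have "g (\<Sum>(x, y)\<in>#p. f x y) = (\<Sum>(x, y)\<in>#p. g (f x y))" for p
    by (induction p) (auto simp: assms)
  then show ?thesis by (simp add: tsum_def)
qed

lemma tsum_linear:
  assumes "Vector_Spaces.linear s t g"
  shows "g (tsum X f) = tsum X (\<lambda>x y. g (f x y))"
proof -
  interpret Vector_Spaces.linear s t g by fact
  show ?thesis by (intro tsum_additive zero add)
qed

lemma tsum_mult_left: "c * tsum X f = tsum X (\<lambda>x y. c * f x y)" for c :: "'a::ring"
  by (rule tsum_additive) (simp_all add: distrib_left)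

lemma tsum_mult_right: "tsum X f * c = tsum X (\<lambda>x y. f x y * c)" for c :: "'a::ring"
  by (rule tsum_additive) (simp_all add: distrib_right)

lemma tsum_scale_right:
  assumes "vector_space s"
  shows "s c (tsum X f) = tsum X (\<lambda>x y. s c (f x y))"
proof -
  interpret vector_space s by fact
  show ?thesis by (rule tsum_additive) (simp_all add: scale_right_distrib)
qed

lemma tsum_tensor_add:
  assumes "X \<in> tensor_space s1 s2" "Y \<in> tensor_space s1 s2" "bilinear_map s1 s2 t f"
  shows "tsum (tensor_add s1 s2 X Y) f = tsum X f + tsum Y f"
  using assms(1,2) unfolding tensor_space_def
  by (auto simp: tensor_add_class tsum_class[OF assms(3)])

lemma bilinear_mapI:
  assumes "\<And>x. Vector_Spaces.linear s2 t (f x)" "\<And>y. Vector_Spaces.linear s1 t (\<lambda>x. f x y)"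
  shows "bilinear_map s1 s2 t f"
  using assms by (simp add: bilinear_map_def)

lemma bilinear_map_vector_space:
  assumes "bilinear_map s1 s2 t f"
  shows "vector_space s1" "vector_space s2" "vector_space t"
  using assms by (auto simp: bilinear_map_def Vector_Spaces.linear_iff)

text \<open>The inner map \<open>g\<close> allows linearity of a nested expression in one variable
  to be reduced, layer by layer, to that of the subterm containing the variable.\<close>

lemma linear_bilinear1:
  assumes "bilinear_map s1 s2 t f" "Vector_Spaces.linear s s1 g"
  shows "Vector_Spaces.linear s t (\<lambda>x. f (g x) c)"
  using assms by (simp add: bilinear_map_def Vector_Spaces.linear_iff)

lemma linear_bilinear2:
  assumes "bilinear_map s1 s2 t f" "Vector_Spaces.linear s s2 g"
  shows "Vector_Spaces.linear s t (\<lambda>x. f c (g x))"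
  using assms by (simp add: bilinear_map_def Vector_Spaces.linear_iff)

lemma linear_comp: "Vector_Spaces.linear s2 t f \<Longrightarrow> Vector_Spaces.linear s s2 g \<Longrightarrow>
  Vector_Spaces.linear s t (\<lambda>x. f (g x))"
  by (simp add: Vector_Spaces.linear_iff)

lemma linear_id': "vector_space s \<Longrightarrow> Vector_Spaces.linear s s (\<lambda>x. x)"
  by (simp add: Vector_Spaces.linear_iff)

lemma bilinear_scale: "vector_space s \<Longrightarrow> bilinear_map (*) s s s"
  by (simp add: bilinear_map_def Vector_Spaces.linear_iff vector_space_field)
    (simp add: vector_space_def mult.commute)

lemmas linear_scale1 = linear_bilinear1[OF bilinear_scale]
lemmas linear_scale2 = linear_bilinear2[OF bilinear_scale]

lemma linear_tsum:
  assumes "vector_space s" "vector_space t" "\<And>a b. Vector_Spaces.linear s t (\<lambda>x. F x a b)"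
  shows "Vector_Spaces.linear s t (\<lambda>x. tsum X (F x))"
proof -
  have *: "\<And>a b x y. F (x + y) a b = F x a b + F y a b" "\<And>a b c x. F (s c x) a b = t c (F x a b)"
    using assms(3) by (simp_all add: Vector_Spaces.linear_iff)
  have "tsum X (F (x + y)) = tsum X (F x) + tsum X (F y)" for x y
    by (simp add: tsum_def * case_prod_unfold sum_mset.distrib)
  moreover have "tsum X (F (s c x)) = t c (tsum X (F x))" for c x
    unfolding tsum_scale_right[OF assms(2)] by (rule tsum_cong) (rule *)
  ultimately show ?thesis
    unfolding Vector_Spaces.linear_iff using assms(1,2) by blast
qed

lemma tensor_linear_space: "tensor_linear s s1 s2 D \<Longrightarrow> D v \<in> tensor_space s1 s2"
  by (simp add: tensor_linear_def)

lemma tsum_tensor_map: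
  assumes "Vector_Spaces.linear s1 t1 f" "Vector_Spaces.linear s2 t2 g" "bilinear_map t1 t2 t F"
    and "X \<in> tensor_space s1 s2"
  shows "tsum (tensor_map t1 t2 f g X) F = tsum X (\<lambda>x y. F (f x) (g y))"
proof -
  have "bilinear_map s1 s2 t (\<lambda>x y. F (f x) (g y))"
    using assms(1-3) by (simp add: bilinear_map_def Vector_Spaces.linear_iff)
  with assms(4) show ?thesis
    by (auto simp: tensor_space_def tensor_map_class[OF assms(1,2)] tsum_class[OF assms(3)] tsum_class
        case_prod_unfold image_mset.compositionality o_def)
qed

lemma tsum_tensor_scale:
  assumes "bilinear_map s1 s2 t f" "X \<in> tensor_space s1 s2"
  shows "tsum (tensor_scale s1 s2 c X) f = t c (tsum X f)"
proof -
  note vs = bilinear_map_vector_space[OF assms(1)]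
  have f': "bilinear_map s1 s2 t (\<lambda>x y. f (s1 c x) y)"
    by (intro bilinear_mapI linear_bilinear1[OF assms(1)] linear_bilinear2[OF assms(1)]
        linear_scale2 linear_id' vs)
  obtain p where X: "X = tensor_class s1 s2 p"
    using assms(2) by (auto simp: tensor_space_def)
  have "tsum (tensor_scale s1 s2 c X) f = tsum X (\<lambda>x y. f (s1 c x) y)"
    unfolding X tensor_scale_class[OF vs(1,2)] tsum_class[OF assms(1)] tsum_class[OF f']
    by (simp add: case_prod_unfold image_mset.compositionality o_def)
  also have "\<dots> = tsum X (\<lambda>x y. t c (f x y))"
    using assms(1) by (simp add: bilinear_map_def Vector_Spaces.linear_iff)
  finally show ?thesis
    by (simp add: tsum_scale_right[OF vs(3)])
qed

text \<open>Contraction with a functional is bilinear, so its value does not depend on the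
  representative chosen by \<open>tsum\<close>; this carries the separation criterion over from
  formal sums to tensors.\<close>

lemma tensor_eqI:
  assumes "vector_space s1" "vector_space s2" "X \<in> tensor_space s1 s2" "Y \<in> tensor_space s1 s2"
    and eq: "\<And>\<phi>. Vector_Spaces.linear s1 (*) \<phi> \<Longrightarrow>
      tsum X (\<lambda>x y. s2 (\<phi> x) y) = tsum Y (\<lambda>x y. s2 (\<phi> x) y)"
  shows "X = Y"
proof -
  obtain p q where X: "X = tensor_class s1 s2 p" and Y: "Y = tensor_class s1 s2 q"
    using assms(3,4) by (auto simp: tensor_space_def)
  show ?thesis unfolding X Y
  proof (rule tensor_class_eqI[OF assms(1,2)])
    fix \<phi> assume phi: "Vector_Spaces.linear s1 (*) \<phi>"
    have "bilinear_map s1 s2 s2 (\<lambda>x y. s2 (\<phi> x) y)"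
      by (intro bilinear_mapI linear_scale1 linear_scale2 linear_id' assms phi)
    with eq[OF phi] show "(\<Sum>(x, y)\<in>#p. s2 (\<phi> x) y) = (\<Sum>(x, y)\<in>#q. s2 (\<phi> x) y)"
      by (simp add: X Y tsum_class)
  qed
qed

section \<open>Threefold tensors and structure maps as nested Sweedler sums\<close>

definition trilinear_map ::
    "('k::field \<Rightarrow> 'a::ab_group_add \<Rightarrow> 'a) \<Rightarrow> ('k \<Rightarrow> 'b::ab_group_add \<Rightarrow> 'b) \<Rightarrow>
     ('k \<Rightarrow> 'c::ab_group_add \<Rightarrow> 'c) \<Rightarrow> ('k \<Rightarrow> 'd::ab_group_add \<Rightarrow> 'd) \<Rightarrow>
     ('a \<Rightarrow> 'b \<Rightarrow> 'c \<Rightarrow> 'd) \<Rightarrow> bool" where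
  "trilinear_map s1 s2 s3 t f \<longleftrightarrow>
     (\<forall>y z. Vector_Spaces.linear s1 t (\<lambda>x. f x y z)) \<and>
     (\<forall>x z. Vector_Spaces.linear s2 t (\<lambda>y. f x y z)) \<and>
     (\<forall>x y. Vector_Spaces.linear s3 t (\<lambda>z. f x y z))"

lemma trilinear_mapI:
  assumes "\<And>y z. Vector_Spaces.linear s1 t (\<lambda>x. f x y z)"
    and "\<And>x z. Vector_Spaces.linear s2 t (\<lambda>y. f x y z)"
    and "\<And>x y. Vector_Spaces.linear s3 t (\<lambda>z. f x y z)"
  shows "trilinear_map s1 s2 s3 t f"
  using assms by (simp add: trilinear_map_def)

lemma tensor3_lift_trilinear:
  assumes "trilinear_map s1 s2 s3 t f"
  shows "tensor3_lift f (tensor3_class s1 s2 s3 p) = (\<Sum>(x, y, z)\<in>#p. f x y z)"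
  by (rule tensor3_lift_class[of s1 t f s2 s3]) (use assms in \<open>simp_all add: trilinear_map_def\<close>)

lemma sum_mset_nested:
  "(\<Sum>w\<in>#(\<Sum>z\<in>#p. G z). h w) = (\<Sum>z\<in>#p. \<Sum>w\<in>#G z. h w)"
  by (induction p) auto

text \<open>Together with its mirror image this translates axioms about threefold tensors, such as
  coassociativity, into equalities of nested sums.\<close>

lemma tensor3_lift_map_left:
  assumes "trilinear_map s1 s2 s3 t f" "tensor_linear s s1 s2 D" "X \<in> tensor_space s s3"
  shows "tensor3_lift f (tensor_map_left s1 s2 s3 D X) = tsum X (\<lambda>x z. tsum (D x) (\<lambda>a b. f a b z))"
proof -
  have vs: "vector_space s1" "vector_space s2"
    using assms(1) by (auto simp: trilinear_map_def Vector_Spaces.linear_iff)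
  \<comment> \<open>Representatives are chosen exactly as in \<open>tsum\<close>, so the result is
    literally a nested \<open>tsum\<close>.\<close>
  have "tensor_map_left s1 s2 s3 D (tensor_class s s3 (SOME p. p \<in> X)) = tensor3_class s1 s2 s3
      (\<Sum>(x, z)\<in>#(SOME p. p \<in> X). {# (a, b, z). (a, b) \<in># (SOME p. p \<in> D x) #})"
    by (rule tensor_map_left_class[OF vs assms(2)])
      (simp add: tensor_class_some[OF tensor_linear_space[OF assms(2)]])
  then show ?thesis
    by (simp add: tensor_class_some[OF assms(3)] tensor3_lift_trilinear[OF assms(1)] tsum_def
        sum_mset_nested case_prod_unfold image_mset.compositionality o_def)
qed

lemma tensor3_lift_map_right:
  assumes "trilinear_map s1 s2 s3 t f" "tensor_linear s s2 s3 D" "X \<in> tensor_space s1 s"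
  shows "tensor3_lift f (tensor_map_right s1 s2 s3 D X) = tsum X (\<lambda>a x. tsum (D x) (\<lambda>b c. f a b c))"
proof -
  have vs: "vector_space s1" "vector_space s2" "vector_space s3"
    using assms(1) by (auto simp: trilinear_map_def Vector_Spaces.linear_iff)
  have "tensor_map_right s1 s2 s3 D (tensor_class s1 s (SOME p. p \<in> X)) = tensor3_class s1 s2 s3
      (\<Sum>(a, x)\<in>#(SOME p. p \<in> X). {# (a, b, c). (b, c) \<in># (SOME p. p \<in> D x) #})"
    by (rule tensor_map_right_class[OF vs assms(2)])
      (simp add: tensor_class_some[OF tensor_linear_space[OF assms(2)]])
  then show ?thesis
    by (simp add: tensor_class_some[OF assms(3)] tensor3_lift_trilinear[OF assms(1)] tsum_def
        sum_mset_nested case_prod_unfold image_mset.compositionality o_def)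
qed

lemma tsum_tensor_map2:
  assumes "bilinear_map s1 s1' t1 f" "bilinear_map s2 s2' t2 g" "bilinear_map t1 t2 t F"
    and "X \<in> tensor_space s1 s2" "Y \<in> tensor_space s1' s2'"
  shows "tsum (tensor_map2 t1 t2 f g X Y) F =
    tsum X (\<lambda>x y. tsum Y (\<lambda>x' y'. F (f x x') (g y y')))"
proof -
  have "tensor_map2 t1 t2 f g X Y = tensor_class t1 t2
      (\<Sum>(x, y)\<in>#(SOME p. p \<in> X). {# (f x x', g y y'). (x', y') \<in># (SOME p. p \<in> Y) #})"
    using tensor_map2_class[OF assms(1,2), of "SOME p. p \<in> X" "SOME p. p \<in> Y"]
    by (simp add: tensor_class_some[OF assms(4)] tensor_class_some[OF assms(5)])
  then have "tsum (tensor_map2 t1 t2 f g X Y) F = (\<Sum>(x, y)\<in>#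
      (\<Sum>(x, y)\<in>#(SOME p. p \<in> X). {# (f x x', g y y'). (x', y') \<in># (SOME p. p \<in> Y) #}). F x y)"
    by (simp only: tsum_class[OF assms(3)])
  then show ?thesis
    by (simp only: tsum_def sum_mset_nested case_prod_unfold image_mset.compositionality o_def
        fst_conv snd_conv)
qed

text \<open>Complements \<open>linear_tsum\<close>: here the tensor varies with \<open>x\<close> and
  the summand is fixed, which is where bilinearity of \<open>f\<close> enters.\<close>

lemma linear_tsum_comult:
  assumes D: "tensor_linear s' s1 s2 D" and g: "Vector_Spaces.linear s s' g"
    and f: "bilinear_map s1 s2 t f"
  shows "Vector_Spaces.linear s t (\<lambda>x. tsum (D (g x)) f)"
  using D g bilinear_map_vector_space[OF f]
  by (simp add: tensor_linear_def Vector_Spaces.linear_iff tsum_tensor_add[OF _ _ f] tsum_tensor_scale[OF f])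

section \<open>Weak bialgebras\<close>

context unital_algebra
begin

lemma bilinear_mult: "bilinear_map scale scale scale (*)"
  by (intro bilinear_mapI)
    (simp_all add: Vector_Spaces.linear_iff vector_space_axioms distrib_left distrib_right
      scale_mult_left scale_mult_right)

lemmas linear_mult1 = linear_bilinear1[OF bilinear_mult]
lemmas linear_mult2 = linear_bilinear2[OF bilinear_mult]

end

context counital_coalgebra
begin

lemmas comult_space = tensor_linear_space[OF comult_linear]
lemmas linear_comult = linear_tsum_comult[OF comult_linear]
lemmas linear_counit = linear_comp[OF counit_linear]

lemma tsum_coassoc:
  assumes "trilinear_map scale scale scale t f"
  shows "tsum (\<Delta> h) (\<lambda>a b. tsum (\<Delta> a) (\<lambda>x y. f x y b)) = tsum (\<Delta> h) (\<lambda>a b. tsum (\<Delta> b) (\<lambda>x y. f a x y))"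
  using arg_cong[OF coassoc, of "tensor3_lift f" h]
  by (simp only: tensor3_lift_map_left[OF assms comult_linear comult_space]
      tensor3_lift_map_right[OF assms comult_linear comult_space])

lemma tsum_counit_right:
  assumes "Vector_Spaces.linear scale t g"
  shows "tsum (\<Delta> h) (\<lambda>a b. t (\<epsilon> b) (g a)) = g h"
proof -
  have "g (tsum (\<Delta> h) (\<lambda>a b. scale (\<epsilon> b) a)) = g h"
    using counit_right[of h]
    by (subst (asm) tensor_lift_eq_tsum[OF comult_space])
      (auto intro!: bilinear_mapI linear_scale1 linear_scale2 linear_id' linear_counit vector_space_axioms)
  then show ?thesis
    using assms by (simp add: tsum_linear[OF assms] Vector_Spaces.linear_iff)
qed

end

context weak_bialgebra
begin

abbreviation L where "L \<equiv> sqcap_L scale \<Delta> \<epsilon>"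
abbreviation R where "R \<equiv> sqcap_R scale \<Delta> \<epsilon>"

lemmas lin0 = bilinear_mapI trilinear_mapI linear_id' vector_space_axioms vector_space_field
  linear_mult1 linear_mult2 linear_scale1 linear_scale2 linear_counit linear_comult linear_tsum

lemma L_eq: "L h = tsum (\<Delta> 1) (\<lambda>a b. scale (\<epsilon> (a * h)) b)"
  unfolding sqcap_L_def by (rule tensor_lift_eq_tsum[OF comult_space, where t = scale]) (intro lin0)

lemma R_eq: "R h = tsum (\<Delta> 1) (\<lambda>a b. scale (\<epsilon> (h * b)) a)"
  unfolding sqcap_R_def by (rule tensor_lift_eq_tsum[OF comult_space, where t = scale]) (intro lin0)

lemma linear_L: "Vector_Spaces.linear scale scale L"
  unfolding L_eq[abs_def] by (intro lin0)

lemma linear_R: "Vector_Spaces.linear scale scale R"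
  unfolding R_eq[abs_def] by (intro lin0)

lemmas lin = lin0 linear_comp[OF linear_L] linear_comp[OF linear_R]

lemma tsum_comult_mult:
  assumes "bilinear_map scale scale t f"
  shows "tsum (\<Delta> (x * y)) f = tsum (\<Delta> x) (\<lambda>a b. tsum (\<Delta> y) (\<lambda>c d. f (a * c) (b * d)))"
  unfolding comult_mult by (rule tsum_tensor_map2[OF bilinear_mult bilinear_mult assms comult_space comult_space])

lemma counit_mult_tsum2: "\<epsilon> (x * y * z) = tsum (\<Delta> y) (\<lambda>a b. \<epsilon> (x * b) * \<epsilon> (a * z))"
  unfolding counit_mult2 by (rule tensor_lift_eq_tsum[OF comult_space, where t = "(*)"]) (intro lin)

lemma
  assumes "trilinear_map scale scale scale t f"
  shows tsum_comult_one1: "tsum (\<Delta> 1) (\<lambda>a b. tsum (\<Delta> a) (\<lambda>x y. f x y b)) =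
      tsum (\<Delta> 1) (\<lambda>a b. tsum (\<Delta> 1) (\<lambda>c d. f a (b * c) d))" (is ?one1)
    and tsum_comult_one2: "tsum (\<Delta> 1) (\<lambda>a b. tsum (\<Delta> a) (\<lambda>x y. f x y b)) =
      tsum (\<Delta> 1) (\<lambda>a b. tsum (\<Delta> 1) (\<lambda>c d. f a (c * b) d))" (is ?one2)
proof -
  let ?p = "SOME p. p \<in> \<Delta> 1"
  have p: "\<Delta> 1 = tensor_class scale scale ?p"
    by (rule tensor_class_some[OF comult_space, symmetric])
  have 1: "tensor_one scale (\<Delta> 1) = tensor3_class scale scale scale {# (x, y, 1). (x, y) \<in># ?p #}"
    by (subst p) (rule tensor_one_class)
  have 2: "one_tensor scale (\<Delta> 1) = tensor3_class scale scale scale {# (1, x, y). (x, y) \<in># ?p #}"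
    by (subst p) (rule one_tensor_class)
  note sums = tensor3_lift_map_left[OF assms comult_linear comult_space] tensor3_mult_class
    tensor3_lift_trilinear[OF assms] tsum_def sum_mset_nested case_prod_unfold
    image_mset.compositionality o_def fst_conv snd_conv mult_1_left mult_1_right
  show ?one1
    using arg_cong[OF comult_one1, of "tensor3_lift f"] by (simp only: 1 2 sums)
  have "tsum (\<Delta> 1) (\<lambda>a b. tsum (\<Delta> a) (\<lambda>x y. f x y b)) =
      tsum (\<Delta> 1) (\<lambda>c d. tsum (\<Delta> 1) (\<lambda>a b. f a (c * b) d))"
    using arg_cong[OF comult_one2, of "tensor3_lift f"] by (simp only: 1 2 sums)
  \<comment> \<open>This product has \<open>1 \<otimes> \<Delta> 1\<close> as its first factor;
    after the exchange of sums the two identities differ only in the order of the product in the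
    middle leg.\<close>
  also have "\<dots> = tsum (\<Delta> 1) (\<lambda>a b. tsum (\<Delta> 1) (\<lambda>c d. f a (c * b) d))"
    by (rule tsum_swap)
  finally show ?one2 .
qed

text \<open>Write \<open>\<Delta> h\<close> as \<open>\<Delta> 1 \<Delta> h\<close> and expand
  \<open>L\<close> by a second copy of \<open>\<Delta> 1\<close>. The two copies merge into the
  iterated coproduct of 1, which makes \<open>\<Delta> (1_1 h)\<close> appear, and the counit
  removes its second leg.\<close>

lemma tsum_comult_L:
  assumes f: "bilinear_map scale scale t f"
  shows "tsum (\<Delta> h) (\<lambda>a b. f a (L b)) = tsum (\<Delta> 1) (\<lambda>a b. f (a * h) b)"
proof -
  note vs = bilinear_map_vector_space[OF f]
  note f_lin = linear_bilinear1[OF f] linear_bilinear2[OF f] vs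
  have "tsum (\<Delta> (1 * h)) (\<lambda>a b. f a (L b)) = 
      tsum (\<Delta> 1) (\<lambda>a b. tsum (\<Delta> h) (\<lambda>c d. f (a * c) (L (b * d))))"
    by (rule tsum_comult_mult[of t]) (intro lin f_lin)
  also have "\<dots> = tsum (\<Delta> 1) (\<lambda>a b. tsum (\<Delta> h) (\<lambda>c d. tsum (\<Delta> 1) (\<lambda>p q. t (\<epsilon> (p * b * d)) (f (a * c) q))))"
  proof -
    have "f x (L y) = tsum (\<Delta> 1) (\<lambda>p q. t (\<epsilon> (p * y)) (f x q))" for x y
      unfolding L_eq using f
      by (subst tsum_linear[of scale t "f x"]) (auto simp: bilinear_map_def Vector_Spaces.linear_iff)
    then show ?thesis by (simp add: mult.assoc)
  qed
  also have "\<dots> = tsum (\<Delta> 1) (\<lambda>a b. tsum (\<Delta> 1) (\<lambda>p q. tsum (\<Delta> h) (\<lambda>c d. t (\<epsilon> (p * b * d)) (f (a * c) q))))"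
    by (intro tsum_cong tsum_swap)
  also have "\<dots> = tsum (\<Delta> 1) (\<lambda>a b. tsum (\<Delta> a) (\<lambda>p q. tsum (\<Delta> h) (\<lambda>c d. t (\<epsilon> (q * d)) (f (p * c) b))))"
    by (rule tsum_comult_one2[of t, symmetric]) (intro lin f_lin)
  also have "\<dots> = tsum (\<Delta> 1) (\<lambda>a b. tsum (\<Delta> (a * h)) (\<lambda>p q. t (\<epsilon> q) (f p b)))"
    by (intro tsum_cong tsum_comult_mult[of t, symmetric] lin f_lin)
  also have "\<dots> = tsum (\<Delta> 1) (\<lambda>a b. f (a * h) b)"
    by (rule tsum_cong, rule tsum_counit_right) (intro f_lin lin)
  finally show ?thesis by simp
qed


text \<open>Expanding \<open>R\<close> yields \<open>\<Delta> h \<Delta> 1 = \<Delta> h\<close> with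
  the counit applied to the second leg.\<close>

lemma tsum_mult_R: "tsum (\<Delta> h) (\<lambda>a b. a * R b) = h"
proof -
  have "tsum (\<Delta> h) (\<lambda>a b. a * R b) = tsum (\<Delta> h) (\<lambda>a b. tsum (\<Delta> 1) (\<lambda>p q. scale (\<epsilon> (b * q)) (a * p)))"
    by (simp add: R_eq tsum_mult_left scale_mult_right)
  also have "\<dots> = tsum (\<Delta> (h * 1)) (\<lambda>a b. scale (\<epsilon> b) a)"
    by (intro tsum_comult_mult[of scale, symmetric] lin)
  also have "\<dots> = h * 1"
    by (rule tsum_counit_right) (intro lin)
  finally show ?thesis by simp
qed

lemma counit_tsum: "\<epsilon> (tsum X f) = tsum X (\<lambda>a b. \<epsilon> (f a b))"
  by (rule tsum_linear[OF counit_linear])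

lemma counit_scale: "\<epsilon> (scale c x) = c * \<epsilon> x"
  using counit_linear by (simp add: Vector_Spaces.linear_iff)

text \<open>\<open>L\<close> sees its argument only through the values of \<open>\<epsilon>\<close>
  on left multiples, and there \<open>L y\<close> can replace \<open>y\<close> by the second counit
  axiom with middle argument 1.\<close>

lemma L_mult_L: "L (x * L y) = L (x * y)"
proof -
  have "\<epsilon> (a * (x * L y)) = \<epsilon> (a * (x * y))" for a
    using counit_mult_tsum2[of "a * x" 1 y]
    by (simp add: L_eq tsum_mult_left scale_mult_right counit_tsum counit_scale mult.assoc mult.commute)
  then show ?thesis by (simp add: L_eq)
qed

lemma R_R_mult: "R (R x * y) = R (x * y)"
proof -
  have "\<epsilon> (R x * y * a) = \<epsilon> (x * y * a)" for a
    using counit_mult_tsum2[of x 1 "y * a"]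
    by (simp add: R_eq tsum_mult_right scale_mult_left counit_tsum counit_scale mult.assoc)
  then show ?thesis by (simp add: R_eq)
qed

text \<open>First \<open>\<Delta> (L y) = 1_1 L y \<otimes> 1_2\<close>, by coassociativity and the
  axiom on the iterated coproduct of 1; then the remaining \<open>\<Delta> 1\<close> is absorbed by
  \<open>\<Delta> x\<close>.\<close>

lemma tsum_comult_mult_L:
  assumes f: "bilinear_map scale scale t f"
  shows "tsum (\<Delta> (x * L y)) f = tsum (\<Delta> x) (\<lambda>a b. f (a * L y) b)"
proof -
  note vs = bilinear_map_vector_space[OF f]
  note f_lin = linear_bilinear1[OF f] linear_bilinear2[OF f] vs
  have L: "tsum (\<Delta> (L y)) g = tsum (\<Delta> 1) (\<lambda>a b. g (a * L y) b)"
    if g: "bilinear_map scale scale t g" for g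
  proof -
    note g_lin = linear_bilinear1[OF g] linear_bilinear2[OF g]
    have lin_g: "Vector_Spaces.linear scale t (\<lambda>x. tsum (\<Delta> x) g)"
      by (intro lin g_lin vs)
    have "tsum (\<Delta> (L y)) g = tsum (\<Delta> 1) (\<lambda>a b. t (\<epsilon> (a * y)) (tsum (\<Delta> b) g))"
      using lin_g unfolding L_eq by (simp add: tsum_linear[OF lin_g] Vector_Spaces.linear_iff)
    also have "\<dots> = tsum (\<Delta> 1) (\<lambda>a b. tsum (\<Delta> b) (\<lambda>c d. t (\<epsilon> (a * y)) (g c d)))"
      by (simp add: tsum_scale_right[OF vs(3)])
    also have "\<dots> = tsum (\<Delta> 1) (\<lambda>a b. tsum (\<Delta> a) (\<lambda>c d. t (\<epsilon> (c * y)) (g d b)))"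
      by (intro tsum_coassoc[of t, symmetric] lin g_lin vs)
    also have "\<dots> = tsum (\<Delta> 1) (\<lambda>a b. tsum (\<Delta> 1) (\<lambda>c d. t (\<epsilon> (a * y)) (g (c * b) d)))"
      by (intro tsum_comult_one2[of t] lin g_lin vs)
    also have "\<dots> = tsum (\<Delta> 1) (\<lambda>c d. tsum (\<Delta> 1) (\<lambda>a b. t (\<epsilon> (a * y)) (g (c * b) d)))"
      by (rule tsum_swap)
    also have "\<dots> = tsum (\<Delta> 1) (\<lambda>c d. g (c * L y) d)"
    proof (rule tsum_cong)
      fix c d
      have lin_gd: "Vector_Spaces.linear scale t (\<lambda>b. g (c * b) d)"
        by (intro lin g_lin vs)
      then show "tsum (\<Delta> 1) (\<lambda>a b. t (\<epsilon> (a * y)) (g (c * b) d)) = g (c * L y) d"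
        unfolding L_eq tsum_linear[OF lin_gd] by (simp add: Vector_Spaces.linear_iff)
    qed
    finally show ?thesis .
  qed
  have "tsum (\<Delta> (x * L y)) f = tsum (\<Delta> x) (\<lambda>a b. tsum (\<Delta> (L y)) (\<lambda>c d. f (a * c) (b * d)))"
    by (intro tsum_comult_mult[of t] f)
  also have "\<dots> = tsum (\<Delta> x) (\<lambda>a b. tsum (\<Delta> 1) (\<lambda>c d. f (a * c * L y) (b * d)))"
    unfolding mult.assoc by (intro tsum_cong L lin f_lin)
  also have "\<dots> = tsum (\<Delta> (x * 1)) (\<lambda>a b. f (a * L y) b)"
    by (intro tsum_comult_mult[of t, symmetric] lin f_lin)
  finally show ?thesis by simp
qed

text \<open>The two orders of the factors in the axiom for the iterated coproduct of 1 give the two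
  positions of \<open>R x\<close>. Having it on the left lets \<open>\<Delta> 1\<close> be absorbed
  by a following \<open>\<Delta> y\<close>; having it on the right lets it meet a following
  antipode.\<close>

lemma tsum_comult_R_one:
  assumes f: "bilinear_map scale scale t f"
  shows "tsum (\<Delta> (R x)) f = tsum (\<Delta> 1) (\<lambda>a b. f a (b * R x))"
    and "tsum (\<Delta> (R x)) f = tsum (\<Delta> 1) (\<lambda>a b. f a (R x * b))"
proof -
  note vs = bilinear_map_vector_space[OF f]
  note f_lin = linear_bilinear1[OF f] linear_bilinear2[OF f] vs
  have lin_f: "Vector_Spaces.linear scale t (\<lambda>x. tsum (\<Delta> x) f)"
    by (intro lin f_lin)
  have comult_R: "tsum (\<Delta> (R x)) f = tsum (\<Delta> 1) (\<lambda>a b. tsum (\<Delta> a) (\<lambda>c d. t (\<epsilon> (x * b)) (f c d)))"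
    using lin_f unfolding R_eq
    by (simp add: tsum_linear[OF lin_f] Vector_Spaces.linear_iff tsum_scale_right[OF vs(3)])
  also have "\<dots> = tsum (\<Delta> 1) (\<lambda>a b. tsum (\<Delta> 1) (\<lambda>c d. t (\<epsilon> (x * d)) (f a (b * c))))"
    by (intro tsum_comult_one1[of t] lin f_lin)
  also have "\<dots> = tsum (\<Delta> 1) (\<lambda>a b. f a (b * R x))"
  proof (rule tsum_cong)
    fix a b
    have l: "Vector_Spaces.linear scale t (\<lambda>c. f a (b * c))"
      by (intro lin f_lin)
    then show "tsum (\<Delta> 1) (\<lambda>c d. t (\<epsilon> (x * d)) (f a (b * c))) = f a (b * R x)"
      unfolding R_eq tsum_linear[OF l] by (simp add: Vector_Spaces.linear_iff)
  qed
  finally show "tsum (\<Delta> (R x)) f = tsum (\<Delta> 1) (\<lambda>a b. f a (b * R x))" .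
  have "tsum (\<Delta> (R x)) f = tsum (\<Delta> 1) (\<lambda>a b. tsum (\<Delta> 1) (\<lambda>c d. t (\<epsilon> (x * d)) (f a (c * b))))"
    unfolding comult_R by (intro tsum_comult_one2[of t] lin f_lin)
  also have "\<dots> = tsum (\<Delta> 1) (\<lambda>a b. f a (R x * b))"
  proof (rule tsum_cong)
    fix a b
    have l: "Vector_Spaces.linear scale t (\<lambda>c. f a (c * b))"
      by (intro lin f_lin)
    then show "tsum (\<Delta> 1) (\<lambda>c d. t (\<epsilon> (x * d)) (f a (c * b))) = f a (R x * b)"
      unfolding R_eq tsum_linear[OF l] by (simp add: Vector_Spaces.linear_iff)
  qed
  finally show "tsum (\<Delta> (R x)) f = tsum (\<Delta> 1) (\<lambda>a b. f a (R x * b))" .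
qed

lemma tsum_comult_R_mult:
  assumes f: "bilinear_map scale scale t f"
  shows "tsum (\<Delta> (R x * y)) f = tsum (\<Delta> y) (\<lambda>a b. f a (R x * b))"
proof -
  note vs = bilinear_map_vector_space[OF f]
  note f_lin = linear_bilinear1[OF f] linear_bilinear2[OF f] vs
  have "tsum (\<Delta> (R x * y)) f = tsum (\<Delta> (R x)) (\<lambda>a b. tsum (\<Delta> y) (\<lambda>c d. f (a * c) (b * d)))"
    by (intro tsum_comult_mult[of t] f)
  also have "\<dots> = tsum (\<Delta> 1) (\<lambda>a b. tsum (\<Delta> y) (\<lambda>c d. f (a * c) (R x * b * d)))"
    by (intro tsum_comult_R_one(2)[of t] lin f_lin)
  also have "\<dots> = tsum (\<Delta> (1 * y)) (\<lambda>a b. f a (R x * b))"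
    unfolding mult.assoc by (intro tsum_comult_mult[of t, symmetric] lin f_lin)
  finally show ?thesis by simp
qed

text \<open>Both products arise from the iterated coproduct of 1 by contracting the outer legs with
  \<open>\<epsilon> (_ y)\<close> and \<open>\<epsilon> (x _)\<close>; the two orders of
  multiplication in its middle leg agree.\<close>

lemma R_mult_L: "R x * L y = L y * R x"
proof -
  have "L y * R x = tsum (\<Delta> 1) (\<lambda>a b. tsum (\<Delta> 1) (\<lambda>c d. scale (\<epsilon> (a * y) * \<epsilon> (x * d)) (b * c)))"
    by (subst tsum_swap) (simp add: L_eq R_eq tsum_mult_right tsum_mult_left scale_mult_left
        scale_mult_right tsum_scale_right[OF vector_space_axioms] mult.commute)
  also have "\<dots> = tsum (\<Delta> 1) (\<lambda>a b. tsum (\<Delta> a) (\<lambda>c d. scale (\<epsilon> (c * y) * \<epsilon> (x * b)) d))"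
    by (intro tsum_comult_one1[of scale, symmetric] lin)
  also have "\<dots> = tsum (\<Delta> 1) (\<lambda>a b. tsum (\<Delta> 1) (\<lambda>c d. scale (\<epsilon> (a * y) * \<epsilon> (x * d)) (c * b)))"
    by (intro tsum_comult_one2[of scale] lin)
  also have "\<dots> = R x * L y"
    by (simp add: L_eq R_eq tsum_mult_right tsum_mult_left scale_mult_left scale_mult_right
        tsum_scale_right[OF vector_space_axioms])
  finally show ?thesis by simp
qed

end

section \<open>Antipode identities in a weak Hopf algebra\<close>

context weak_hopf_algebra
begin

lemmas lin_S = lin linear_comp[OF antipode_linear]

lemma tsum_mult_antipode: "tsum (\<Delta> h) (\<lambda>a b. a * S b) = L h"
  unfolding antipode_right[symmetric]
  by (rule tensor_lift_eq_tsum[OF comult_space, where t = scale, symmetric]) (intro lin_S)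

lemma tsum_antipode_mult: "tsum (\<Delta> h) (\<lambda>a b. S a * b) = R h"
  unfolding antipode_left[symmetric]
  by (rule tensor_lift_eq_tsum[OF comult_space, where t = scale, symmetric]) (intro lin_S)

lemma antipode_eq_R: "S h = tsum (\<Delta> h) (\<lambda>a b. R a * S b)"
proof -
  have "S h = tsum (\<Delta> h) (\<lambda>a b. tsum (\<Delta> a) (\<lambda>x y. S x * y * S b))"
    unfolding antipode_antipode[of h, symmetric]
    by (rule tensor3_lift_map_left[OF _ comult_linear comult_space, where t = scale]) (intro lin_S)
  then show ?thesis
    by (simp only: tsum_antipode_mult[symmetric] tsum_mult_right)
qed

lemma antipode_eq_L: "S h = tsum (\<Delta> h) (\<lambda>a b. S a * L b)"
proof -
  have "S h = tsum (\<Delta> h) (\<lambda>a b. tsum (\<Delta> a) (\<lambda>x y. S x * y * S b))"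
    by (subst antipode_eq_R) (simp only: tsum_antipode_mult[symmetric] tsum_mult_right)
  \<comment> \<open>Coassociativity groups the last two factors of \<open>S h_1 h_2 S h_3\<close>
    instead of the first two.\<close>
  also have "\<dots> = tsum (\<Delta> h) (\<lambda>a b. tsum (\<Delta> b) (\<lambda>x y. S a * x * S y))"
    by (intro tsum_coassoc[of scale] lin_S)
  finally show ?thesis
    by (simp only: tsum_mult_antipode[symmetric] tsum_mult_left mult.assoc)
qed

text \<open>Inside \<open>L\<close> the factor \<open>y\<close> may be replaced by
  \<open>L y\<close>, which enters only the first leg of the coproduct of \<open>x L y\<close>;
  expanding it as \<open>y_1 S y_2\<close> gives the nested sum. The next lemma is the mirror
  image.\<close>

lemma L_mult_eq: "L (x * y) = tsum (\<Delta> x) (\<lambda>a b. tsum (\<Delta> y) (\<lambda>c d. a * c * S d * S b))"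
proof -
  have "L (x * y) = tsum (\<Delta> (x * L y)) (\<lambda>a b. a * S b)"
    by (simp only: tsum_mult_antipode L_mult_L)
  also have "\<dots> = tsum (\<Delta> x) (\<lambda>a b. a * L y * S b)"
    by (intro tsum_comult_mult_L[of scale] lin_S)
  finally show ?thesis
    by (simp only: tsum_mult_antipode[symmetric] tsum_mult_left tsum_mult_right mult.assoc)
qed

lemma R_mult_eq: "R (x * y) = tsum (\<Delta> x) (\<lambda>a b. tsum (\<Delta> y) (\<lambda>c d. S c * S a * b * d))"
proof -
  have "R (x * y) = tsum (\<Delta> (R x * y)) (\<lambda>a b. S a * b)"
    by (simp only: tsum_antipode_mult R_R_mult)
  also have "\<dots> = tsum (\<Delta> y) (\<lambda>c d. S c * (R x * d))"
    by (intro tsum_comult_R_mult[of scale] lin_S)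
  also have "\<dots> = tsum (\<Delta> y) (\<lambda>c d. tsum (\<Delta> x) (\<lambda>a b. S c * S a * b * d))"
    by (simp only: tsum_antipode_mult[symmetric] tsum_mult_left tsum_mult_right mult.assoc)
  also have "\<dots> = tsum (\<Delta> x) (\<lambda>a b. tsum (\<Delta> y) (\<lambda>c d. S c * S a * b * d))"
    by (rule tsum_swap)
  finally show ?thesis .
qed

text \<open>
  Convolution of maps \<open>H \<otimes> H \<rightarrow> H\<close>: let \<open>\<mu>\<close> be the multiplication, \<open>F\<close> and \<open>G\<close> the two sides of the
  claim.  Then \<open>\<mu> * F = \<mu> * G = L \<circ> \<mu>\<close> and \<open>F * \<mu> = G * \<mu> = R \<circ> \<mu>\<close>, so
  \<open>F = F * \<mu> * F = F * \<mu> * G = G * \<mu> * G = G\<close>.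
\<close>
lemma antipode_mult: "S (x * y) = S y * S x"
proof -
  have "S (x * y) = tsum (\<Delta> x) (\<lambda>a b. tsum (\<Delta> y) (\<lambda>c d. S (a * c) * L (b * d)))"
    by (subst antipode_eq_L) (intro tsum_comult_mult[of scale] lin_S)
  also have "\<dots> = tsum (\<Delta> x) (\<lambda>a b. tsum (\<Delta> y) (\<lambda>c d. tsum (\<Delta> b) (\<lambda>p q.
      tsum (\<Delta> d) (\<lambda>u v. S (a * c) * (p * u) * S v * S q))))"
    by (simp only: L_mult_eq tsum_mult_left mult.assoc)
  \<comment> \<open>The sums are reordered so that coassociativity can be applied to
    \<open>x\<close> and to \<open>y\<close> separately; this rebrackets the triple
    convolution.\<close>
  also have "\<dots> = tsum (\<Delta> x) (\<lambda>a b. tsum (\<Delta> b) (\<lambda>p q. tsum (\<Delta> y) (\<lambda>c d.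
      tsum (\<Delta> d) (\<lambda>u v. S (a * c) * (p * u) * S v * S q))))"
    by (rule tsum_cong, rule tsum_swap)
  also have "\<dots> = tsum (\<Delta> x) (\<lambda>a b. tsum (\<Delta> b) (\<lambda>p q. tsum (\<Delta> y) (\<lambda>c d.
      tsum (\<Delta> c) (\<lambda>u v. S (a * u) * (p * v) * S d * S q))))"
    by (intro tsum_cong tsum_coassoc[of scale, symmetric] lin_S)
  also have "\<dots> = tsum (\<Delta> x) (\<lambda>a b. tsum (\<Delta> a) (\<lambda>p q. tsum (\<Delta> y) (\<lambda>c d.
      tsum (\<Delta> c) (\<lambda>u v. S (p * u) * (q * v) * S d * S b))))"
    by (intro tsum_coassoc[of scale, symmetric] lin_S)
  also have "\<dots> = tsum (\<Delta> x) (\<lambda>a b. tsum (\<Delta> y) (\<lambda>c d. tsum (\<Delta> a) (\<lambda>p q.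
      tsum (\<Delta> c) (\<lambda>u v. S (p * u) * (q * v) * S d * S b))))"
    by (rule tsum_cong, rule tsum_swap)
  also have "\<dots> = tsum (\<Delta> x) (\<lambda>a b. tsum (\<Delta> y) (\<lambda>c d. R (a * c) * S d * S b))"
  proof -
    have "tsum (\<Delta> a) (\<lambda>p q. tsum (\<Delta> c) (\<lambda>u v. S (p * u) * (q * v))) = R (a * c)" for a c
      unfolding tsum_antipode_mult[symmetric] by (intro tsum_comult_mult[of scale, symmetric] lin_S)
    then show ?thesis by (simp only: tsum_mult_right[symmetric])
  qed
  \<comment> \<open>Here \<open>F\<close> is exchanged for \<open>G\<close>: the same
    \<open>R (a * c)\<close> is now expanded as the convolution of \<open>G\<close> with the
    multiplication.\<close>
  also have "\<dots> = tsum (\<Delta> x) (\<lambda>a b. tsum (\<Delta> y) (\<lambda>c d. tsum (\<Delta> a) (\<lambda>p q.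
      tsum (\<Delta> c) (\<lambda>u v. S u * S p * q * v * S d * S b))))"
    by (simp only: R_mult_eq tsum_mult_right)
  also have "\<dots> = tsum (\<Delta> x) (\<lambda>a b. tsum (\<Delta> a) (\<lambda>p q. tsum (\<Delta> y) (\<lambda>c d.
      tsum (\<Delta> c) (\<lambda>u v. S u * S p * q * v * S d * S b))))"
    by (rule tsum_cong, rule tsum_swap)
  also have "\<dots> = tsum (\<Delta> x) (\<lambda>a b. tsum (\<Delta> a) (\<lambda>p q. tsum (\<Delta> y) (\<lambda>c d.
      tsum (\<Delta> d) (\<lambda>u v. S c * S p * q * u * S v * S b))))"
    by (intro tsum_cong tsum_coassoc[of scale] lin_S)
  also have "\<dots> = tsum (\<Delta> x) (\<lambda>a b. tsum (\<Delta> a) (\<lambda>p q. tsum (\<Delta> y) (\<lambda>c d. S c * (S p * q) * L d * S b)))"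
    by (simp only: tsum_mult_antipode[symmetric] tsum_mult_left tsum_mult_right mult.assoc)
  also have "\<dots> = tsum (\<Delta> x) (\<lambda>a b. tsum (\<Delta> y) (\<lambda>c d. tsum (\<Delta> a) (\<lambda>p q. S c * (S p * q) * L d * S b)))"
    by (rule tsum_cong, rule tsum_swap)
  also have "\<dots> = tsum (\<Delta> x) (\<lambda>a b. tsum (\<Delta> y) (\<lambda>c d. S c * R a * L d * S b))"
    by (simp only: tsum_mult_left[symmetric] tsum_mult_right[symmetric] tsum_antipode_mult)
  \<comment> \<open>Commuting \<open>R a\<close> past \<open>L d\<close> separates the
    \<open>y\<close>-part \<open>S y_1 L y_2 = S y\<close> from the \<open>x\<close>-part
    \<open>R x_1 S x_2 = S x\<close>.\<close>
  also have "\<dots> = tsum (\<Delta> x) (\<lambda>a b. tsum (\<Delta> y) (\<lambda>c d. (S c * L d) * (R a * S b)))"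
  proof -
    have "S c * R a * L d * S b = (S c * L d) * (R a * S b)" for a b c d
      using R_mult_L[of a d] by (metis mult.assoc)
    then show ?thesis by (simp only:)
  qed
  also have "\<dots> = S y * S x"
    by (simp only: tsum_mult_left[symmetric] tsum_mult_right[symmetric]
        antipode_eq_L[of y, symmetric] antipode_eq_R[of x, symmetric])
  finally show ?thesis .
qed


text \<open>Read from the right: in \<open>h_1 S h_4 \<otimes> h_2 S h_3\<close> the second leg
  collapses to \<open>L h_2\<close>, \<open>tsum_comult_L\<close> trades it for a copy of
  \<open>\<Delta> 1\<close>, and the first leg collapses to \<open>L h\<close>. So
  \<open>S h_2 \<otimes> S h_1\<close> acts as a right convolution inverse of
  \<open>\<Delta>\<close>, up to \<open>L\<close>.\<close>

lemma tsum_one_L: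
  assumes f: "bilinear_map scale scale t f"
  shows "tsum (\<Delta> 1) (\<lambda>p q. f (p * L h) q) = tsum (\<Delta> h) (\<lambda>a b. tsum (\<Delta> a) (\<lambda>u v.
    tsum (\<Delta> b) (\<lambda>p q. f (u * S q) (v * S p))))"
proof -
  note vs = bilinear_map_vector_space[OF f]
  note f_lin = linear_bilinear1[OF f] linear_bilinear2[OF f] vs
  have "tsum (\<Delta> h) (\<lambda>a b. tsum (\<Delta> a) (\<lambda>u v. tsum (\<Delta> b) (\<lambda>p q. f (u * S q) (v * S p)))) =
      tsum (\<Delta> h) (\<lambda>a b. tsum (\<Delta> b) (\<lambda>u v. tsum (\<Delta> v) (\<lambda>p q. f (a * S q) (u * S p))))"
    by (intro tsum_coassoc[of t] lin_S f_lin)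
  also have "\<dots> = tsum (\<Delta> h) (\<lambda>a b. tsum (\<Delta> b) (\<lambda>u v. tsum (\<Delta> u) (\<lambda>p q. f (a * S v) (p * S q))))"
    by (intro tsum_cong tsum_coassoc[of t, symmetric] lin_S f_lin)
  also have "\<dots> = tsum (\<Delta> h) (\<lambda>a b. tsum (\<Delta> b) (\<lambda>u v. f (a * S v) (L u)))"
    unfolding tsum_mult_antipode[symmetric] using f
    by (subst tsum_linear[of scale t "f _"]) (auto simp: bilinear_map_def)
  also have "\<dots> = tsum (\<Delta> h) (\<lambda>a b. tsum (\<Delta> a) (\<lambda>u v. f (u * S b) (L v)))"
    by (intro tsum_coassoc[of t, symmetric] lin_S f_lin)
  also have "\<dots> = tsum (\<Delta> h) (\<lambda>a b. tsum (\<Delta> 1) (\<lambda>p q. f (p * a * S b) q))"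
    by (rule tsum_cong, rule tsum_comult_L[of t "\<lambda>u v. f (u * S _) v"]) (intro lin_S f_lin)
  also have "\<dots> = tsum (\<Delta> 1) (\<lambda>p q. tsum (\<Delta> h) (\<lambda>a b. f (p * a * S b) q))"
    by (rule tsum_swap)
  also have "\<dots> = tsum (\<Delta> 1) (\<lambda>p q. f (p * L h) q)"
  proof (rule tsum_cong)
    fix p q
    have l: "Vector_Spaces.linear scale t (\<lambda>x. f (p * x) q)"
      by (intro lin_S f_lin)
    show "tsum (\<Delta> h) (\<lambda>a b. f (p * a * S b) q) = f (p * L h) q"
      unfolding tsum_mult_antipode[symmetric] tsum_linear[OF l] mult.assoc ..
  qed
  finally show ?thesis ..
qed

text \<open>
  The left factor \<open>\<Delta> 1\<close> is redundant, but removing it would cost extra work and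
  \<open>\<rho> m = \<rho> m \<cdot> \<Delta> 1\<close> absorbs it in a Hopf module.
\<close>
lemma tsum_comult_antipode:
  assumes f: "bilinear_map scale scale t f"
  shows "tsum (\<Delta> (S h)) f = tsum (\<Delta> 1) (\<lambda>p q. tsum (\<Delta> h) (\<lambda>a b. f (p * S b) (q * S a)))"
proof -
  note vs = bilinear_map_vector_space[OF f]
  note f_lin = linear_bilinear1[OF f] linear_bilinear2[OF f] vs
  have lin_f: "Vector_Spaces.linear scale t (\<lambda>x. tsum (\<Delta> x) f)"
    by (intro lin f_lin)
  have "tsum (\<Delta> (S h)) f = tsum (\<Delta> h) (\<lambda>a b. tsum (\<Delta> (S a * L b)) f)"
    by (subst antipode_eq_L) (rule tsum_linear[OF lin_f])
  \<comment> \<open>The factor 1 supplies the copy of \<open>\<Delta> 1\<close> that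
    \<open>tsum_one_L\<close> requires.\<close>
  also have "\<dots> = tsum (\<Delta> h) (\<lambda>a b. tsum (\<Delta> (S a * 1)) (\<lambda>u v. f (u * L b) v))"
    by (simp add: tsum_comult_mult_L[OF f])
  also have "\<dots> = tsum (\<Delta> h) (\<lambda>a b. tsum (\<Delta> (S a)) (\<lambda>u v. tsum (\<Delta> 1) (\<lambda>p q. f (u * p * L b) (v * q))))"
    by (intro tsum_cong tsum_comult_mult[of t] lin_S f_lin)
  also have "\<dots> = tsum (\<Delta> h) (\<lambda>a b. tsum (\<Delta> (S a)) (\<lambda>u v. tsum (\<Delta> b) (\<lambda>c d. tsum (\<Delta> c) (\<lambda>p q.
      tsum (\<Delta> d) (\<lambda>x y. f (u * (p * S y)) (v * (q * S x)))))))"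
    unfolding mult.assoc by (intro tsum_cong tsum_one_L[of t "\<lambda>x y. f (_ * x) (_ * y)"] lin_S f_lin)
  also have "\<dots> = tsum (\<Delta> h) (\<lambda>a b. tsum (\<Delta> b) (\<lambda>c d. tsum (\<Delta> (S a)) (\<lambda>u v. tsum (\<Delta> c) (\<lambda>p q.
      tsum (\<Delta> d) (\<lambda>x y. f (u * p * S y) (v * q * S x))))))"
    unfolding mult.assoc by (rule tsum_cong, rule tsum_swap)
  \<comment> \<open>The coproducts of \<open>S h_1\<close> and \<open>h_2\<close> merge, so that
    \<open>S h_1 h_2\<close> can contract to \<open>R h_1\<close> after coassociativity.\<close>
  also have "\<dots> = tsum (\<Delta> h) (\<lambda>a b. tsum (\<Delta> b) (\<lambda>c d. tsum (\<Delta> (S a * c)) (\<lambda>u v.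
      tsum (\<Delta> d) (\<lambda>x y. f (u * S y) (v * S x)))))"
    by (intro tsum_cong tsum_comult_mult[of t, symmetric] lin_S f_lin)
  also have "\<dots> = tsum (\<Delta> h) (\<lambda>a b. tsum (\<Delta> a) (\<lambda>c d. tsum (\<Delta> (S c * d)) (\<lambda>u v.
      tsum (\<Delta> b) (\<lambda>x y. f (u * S y) (v * S x)))))"
    by (intro tsum_coassoc[of t, symmetric] lin_S f_lin)
  also have "\<dots> = tsum (\<Delta> h) (\<lambda>a b. tsum (\<Delta> (R a)) (\<lambda>u v. tsum (\<Delta> b) (\<lambda>x y. f (u * S y) (v * S x))))"
  proof (rule tsum_cong)
    fix a b
    have l: "Vector_Spaces.linear scale t (\<lambda>z. tsum (\<Delta> z) (\<lambda>u v. tsum (\<Delta> b) (\<lambda>x y. f (u * S y) (v * S x))))"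
      by (intro lin_S f_lin)
    show "tsum (\<Delta> a) (\<lambda>c d. tsum (\<Delta> (S c * d)) (\<lambda>u v. tsum (\<Delta> b) (\<lambda>x y. f (u * S y) (v * S x)))) =
        tsum (\<Delta> (R a)) (\<lambda>u v. tsum (\<Delta> b) (\<lambda>x y. f (u * S y) (v * S x)))"
      unfolding tsum_antipode_mult[symmetric] tsum_linear[OF l] ..
  qed
  \<comment> \<open>\<open>R a\<close> is placed to the right of \<open>1_2\<close>, next to
    \<open>S x\<close>, so that \<open>R h_1 S h_2 = S h\<close> finishes the computation.\<close>
  also have "\<dots> = tsum (\<Delta> h) (\<lambda>a b. tsum (\<Delta> 1) (\<lambda>p q. tsum (\<Delta> b) (\<lambda>x y. f (p * S y) (q * R a * S x))))"
    by (intro tsum_cong tsum_comult_R_one(1)[of t] lin_S f_lin)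
  also have "\<dots> = tsum (\<Delta> 1) (\<lambda>p q. tsum (\<Delta> h) (\<lambda>a b. tsum (\<Delta> b) (\<lambda>x y. f (p * S y) (q * R a * S x))))"
    by (rule tsum_swap)
  also have "\<dots> = tsum (\<Delta> 1) (\<lambda>p q. tsum (\<Delta> h) (\<lambda>a b. tsum (\<Delta> a) (\<lambda>x y. f (p * S b) (q * R x * S y))))"
    by (intro tsum_cong tsum_coassoc[of t, symmetric] lin_S f_lin)
  also have "\<dots> = tsum (\<Delta> 1) (\<lambda>p q. tsum (\<Delta> h) (\<lambda>a b. f (p * S b) (q * S a)))"
  proof (intro tsum_cong)
    fix p q a b
    have l: "Vector_Spaces.linear scale t (\<lambda>z. f (p * S b) (q * z))"
      by (intro lin_S f_lin)
    show "tsum (\<Delta> a) (\<lambda>x y. f (p * S b) (q * R x * S y)) = f (p * S b) (q * S a)"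
      unfolding antipode_eq_R[of a] tsum_linear[OF l] mult.assoc ..
  qed
  finally show ?thesis .
qed

end

section \<open>Weak Hopf modules\<close>

context weak_right_hopf_module
begin

lemmas coact_space = tensor_linear_space[OF coact_linear]

lemmas lin_M = lin M.vector_space_axioms linear_bilinear1[OF act_bilinear] linear_bilinear2[OF act_bilinear]
  linear_tsum_comult[OF coact_linear]

lemma tsum_coact_coassoc:
  assumes "trilinear_map scaleM scaleH scaleH t f"
  shows "tsum (\<rho> m) (\<lambda>a b. tsum (\<rho> a) (\<lambda>x y. f x y b)) = tsum (\<rho> m) (\<lambda>a b. tsum (\<Delta> b) (\<lambda>x y. f a x y))"
  using arg_cong[OF coact_coassoc, of "tensor3_lift f" m]
  by (simp only: tensor3_lift_map_left[OF assms coact_linear coact_space]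
      tensor3_lift_map_right[OF assms comult_linear coact_space])

lemma tsum_coact_act:
  assumes "bilinear_map scaleM scaleH t f"
  shows "tsum (\<rho> (act m h)) f = tsum (\<rho> m) (\<lambda>a b. tsum (\<Delta> h) (\<lambda>c d. f (act a c) (b * d)))"
  unfolding coact_act by (rule tsum_tensor_map2[OF act_bilinear bilinear_mult assms coact_space comult_space])

end

section \<open>Hopf modules over a weak Hopf algebra and the map \<open>E\<close>\<close>

locale weak_hopf_algebra_module =
  weak_hopf_algebra scaleH \<Delta> \<epsilon> S + weak_right_hopf_module scaleH \<Delta> \<epsilon> scaleM act \<rho>
  for scaleH :: "'k::field \<Rightarrow> 'h::{ring,monoid_mult} \<Rightarrow> 'h"
    and \<Delta> :: "'h \<Rightarrow> ('h, 'h) tensor" and \<epsilon> :: "'h \<Rightarrow> 'k" and S :: "'h \<Rightarrow> 'h"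
    and scaleM :: "'k \<Rightarrow> 'm::ab_group_add \<Rightarrow> 'm"
    and act :: "'m \<Rightarrow> 'h \<Rightarrow> 'm" and \<rho> :: "'m \<Rightarrow> ('m, 'h) tensor"
begin

definition E :: "'m \<Rightarrow> 'm" where
  "E m = tsum (\<rho> m) (\<lambda>a b. act a (S b))"

lemmas lin_MS = lin_M linear_comp[OF antipode_linear]

lemma linear_E: "Vector_Spaces.linear scaleM scaleM E"
  unfolding E_def[abs_def] by (intro lin_MS)

lemmas lin_MSE = lin_MS linear_comp[OF linear_E]

lemma tsum_coact_act_antipode:
  assumes f: "bilinear_map scaleM scaleH t f"
  shows "tsum (\<rho> (act m (S h))) f = tsum (\<rho> m) (\<lambda>a b. tsum (\<Delta> h) (\<lambda>c d. f (act a (S d)) (b * S c)))"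
proof -
  note vs = bilinear_map_vector_space[OF f]
  note f_lin = linear_bilinear1[OF f] linear_bilinear2[OF f] vs
  have "tsum (\<rho> (act m (S h))) f = tsum (\<rho> m) (\<lambda>a b. tsum (\<Delta> (S h)) (\<lambda>c d. f (act a c) (b * d)))"
    by (rule tsum_coact_act[OF f])
  also have "\<dots> = tsum (\<rho> m) (\<lambda>a b. tsum (\<Delta> 1) (\<lambda>p q. tsum (\<Delta> h) (\<lambda>c d. f (act a (p * S d)) (b * (q * S c)))))"
    by (intro tsum_cong tsum_comult_antipode[of t] lin_MS f_lin)
  also have "\<dots> = tsum (\<rho> m) (\<lambda>a b. tsum (\<Delta> 1) (\<lambda>p q. tsum (\<Delta> h) (\<lambda>c d. f (act (act a p) (S d)) (b * q * S c))))"
    by (simp only: act_act mult.assoc)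
  \<comment> \<open>The extra \<open>\<Delta> 1\<close> from the coproduct of \<open>S h\<close> is
    absorbed as \<open>\<rho> m \<Delta> 1 = \<rho> (m \<cdot> 1)\<close>.\<close>
  also have "\<dots> = tsum (\<rho> (act m 1)) (\<lambda>a b. tsum (\<Delta> h) (\<lambda>c d. f (act a (S d)) (b * S c)))"
    by (intro tsum_coact_act[of t, symmetric] lin_MS f_lin)
  finally show ?thesis by (simp only: act_one)
qed

text \<open>The antipode flips the legs, so the second one is \<open>m_1 S m_2\<close>, which
  coassociativity collapses to \<open>L\<close>, while the last antipode stays with the module
  factor.\<close>

lemma tsum_coact_E:
  assumes f: "bilinear_map scaleM scaleH t f"
  shows "tsum (\<rho> (E m)) f = tsum (\<rho> m) (\<lambda>a b. tsum (\<Delta> b) (\<lambda>c d. f (act a (S d)) (L c)))"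
proof -
  note vs = bilinear_map_vector_space[OF f]
  note f_lin = linear_bilinear1[OF f] linear_bilinear2[OF f] vs
  have lin_f: "Vector_Spaces.linear scaleM t (\<lambda>x. tsum (\<rho> x) f)"
    by (intro lin_MS f_lin)
  have "tsum (\<rho> (E m)) f = tsum (\<rho> m) (\<lambda>a b. tsum (\<rho> (act a (S b))) f)"
    unfolding E_def by (rule tsum_linear[OF lin_f])
  also have "\<dots> = tsum (\<rho> m) (\<lambda>a b. tsum (\<rho> a) (\<lambda>u v. tsum (\<Delta> b) (\<lambda>c d. f (act u (S d)) (v * S c))))"
    by (simp only: tsum_coact_act_antipode[OF f])
  also have "\<dots> = tsum (\<rho> m) (\<lambda>a b. tsum (\<Delta> b) (\<lambda>u v. tsum (\<Delta> v) (\<lambda>c d. f (act a (S d)) (u * S c))))"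
    by (intro tsum_coact_coassoc[of t] lin_MS f_lin)
  also have "\<dots> = tsum (\<rho> m) (\<lambda>a b. tsum (\<Delta> b) (\<lambda>u v. tsum (\<Delta> u) (\<lambda>c d. f (act a (S v)) (c * S d))))"
    by (intro tsum_cong tsum_coassoc[of t, symmetric] lin_MS f_lin)
  also have "\<dots> = tsum (\<rho> m) (\<lambda>a b. tsum (\<Delta> b) (\<lambda>u v. f (act a (S v)) (L u)))"
    unfolding tsum_mult_antipode[symmetric] using f
    by (subst tsum_linear[of scaleH t "f _"]) (auto simp: bilinear_map_def)
  finally show ?thesis .
qed

text \<open>Since \<open>S\<close> reverses products, \<open>S h_2 S (m_1 S h_1)\<close> becomes
  \<open>S (m_1 S h_1 h_2)\<close>, in which \<open>S h_1 h_2\<close> sums to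
  \<open>R h\<close>.\<close>

lemma E_act_antipode: "E (act m (S h)) = tsum (\<rho> m) (\<lambda>a b. act a (S (b * R h)))"
proof -
  have "E (act m (S h)) = tsum (\<rho> m) (\<lambda>a b. tsum (\<Delta> h) (\<lambda>c d. act (act a (S d)) (S (b * S c))))"
    unfolding E_def by (intro tsum_coact_act_antipode[of scaleM] lin_MS)
  also have "\<dots> = tsum (\<rho> m) (\<lambda>a b. tsum (\<Delta> h) (\<lambda>c d. act a (S (b * (S c * d)))))"
    by (simp only: act_act mult.assoc flip: antipode_mult)
  also have "\<dots> = tsum (\<rho> m) (\<lambda>a b. act a (S (b * R h)))"
  proof (rule tsum_cong)
    fix a b
    have l: "Vector_Spaces.linear scaleH scaleM (\<lambda>x. act a (S (b * x)))"
      by (intro lin_MS)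
    show "tsum (\<Delta> h) (\<lambda>c d. act a (S (b * (S c * d)))) = act a (S (b * R h))"
      unfolding tsum_antipode_mult[symmetric] tsum_linear[OF l] ..
  qed
  finally show ?thesis .
qed

text \<open>The second leg of \<open>\<rho> (E m)\<close> consists of values of \<open>L\<close>,
  and \<open>L\<close> is idempotent.\<close>

lemma tsum_coact_E_L:
  assumes f: "bilinear_map scaleM scaleH t f"
  shows "tsum (\<rho> (E m)) (\<lambda>a b. f a (L b)) = tsum (\<rho> (E m)) f"
proof -
  note vs = bilinear_map_vector_space[OF f]
  note f_lin = linear_bilinear1[OF f] linear_bilinear2[OF f] vs
  have "L (L h) = L h" for h
    using L_mult_L[of 1 h] by simp
  moreover have "bilinear_map scaleM scaleH t (\<lambda>a b. f a (L b))"
    by (intro lin_M f_lin)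
  ultimately show ?thesis
    by (simp only: tsum_coact_E[OF f] tsum_coact_E)
qed

lemma tsum_coact_E_E:
  assumes f: "bilinear_map scaleM scaleH t f"
  shows "tsum (\<rho> (E m)) (\<lambda>a b. f (E a) b) = tsum (\<rho> m) (\<lambda>a b. f (E a) (L b))"
proof -
  note vs = bilinear_map_vector_space[OF f]
  note f_lin = linear_bilinear1[OF f] linear_bilinear2[OF f] vs
  have push: "f (tsum X g) y = tsum X (\<lambda>a b. f (g a b) y)" for X :: "('m, 'h) tensor" and g y
    using f by (subst tsum_linear[of scaleM t "\<lambda>x. f x y"]) (auto simp: bilinear_map_def)
  have "tsum (\<rho> (E m)) (\<lambda>a b. f (E a) b) = tsum (\<rho> m) (\<lambda>a b. tsum (\<Delta> b) (\<lambda>c d. f (E (act a (S d))) (L c)))"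
    by (intro tsum_coact_E[of t] lin_MSE f_lin)
  also have "\<dots> = tsum (\<rho> m) (\<lambda>a b. tsum (\<Delta> b) (\<lambda>c d. tsum (\<rho> a) (\<lambda>u v. f (act u (S (v * R d))) (L c))))"
    by (simp only: E_act_antipode push)
  also have "\<dots> = tsum (\<rho> m) (\<lambda>a b. tsum (\<rho> a) (\<lambda>u v. tsum (\<Delta> b) (\<lambda>c d. f (act u (S (v * R d))) (L c))))"
    by (rule tsum_cong, rule tsum_swap)
  also have "\<dots> = tsum (\<rho> m) (\<lambda>a b. tsum (\<Delta> b) (\<lambda>u v. tsum (\<Delta> v) (\<lambda>c d. f (act a (S (u * R d))) (L c))))"
    by (intro tsum_coact_coassoc[of t] lin_MS f_lin)
  also have "\<dots> = tsum (\<rho> m) (\<lambda>a b. tsum (\<Delta> b) (\<lambda>u v. tsum (\<Delta> u) (\<lambda>c d. f (act a (S (c * R v))) (L d))))"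
    by (intro tsum_cong tsum_coassoc[of t, symmetric] lin_MS f_lin)
  \<comment> \<open>Trading \<open>L\<close> for a copy of \<open>\<Delta> 1\<close> frees the
    second leg from \<open>m\<close>, so that \<open>u\<close> and \<open>R v\<close> become
    adjacent legs of one coproduct and contract.\<close>
  also have "\<dots> = tsum (\<rho> m) (\<lambda>a b. tsum (\<Delta> b) (\<lambda>u v. tsum (\<Delta> 1) (\<lambda>p q. f (act a (S (p * u * R v))) q)))"
    by (intro tsum_cong tsum_comult_L[of t "\<lambda>c d. f (act _ (S (c * R _))) d"] lin_MS f_lin)
  also have "\<dots> = tsum (\<rho> m) (\<lambda>a b. tsum (\<Delta> 1) (\<lambda>p q. tsum (\<Delta> b) (\<lambda>u v. f (act a (S (p * u * R v))) q)))"
    by (rule tsum_cong, rule tsum_swap)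
  also have "\<dots> = tsum (\<rho> m) (\<lambda>a b. tsum (\<Delta> 1) (\<lambda>p q. f (act a (S (p * b))) q))"
  proof (intro tsum_cong)
    fix a b p q
    have l: "Vector_Spaces.linear scaleH t (\<lambda>x. f (act a (S (p * x))) q)"
      by (intro lin_MS f_lin)
    show "tsum (\<Delta> b) (\<lambda>u v. f (act a (S (p * u * R v))) q) = f (act a (S (p * b))) q"
      unfolding mult.assoc tsum_linear[OF l, symmetric] tsum_mult_R ..
  qed
  \<comment> \<open>The same identity read backwards restores \<open>L\<close> in the second
    leg.\<close>
  also have "\<dots> = tsum (\<rho> m) (\<lambda>a b. tsum (\<Delta> b) (\<lambda>c d. f (act a (S c)) (L d)))"
    by (intro tsum_cong tsum_comult_L[of t "\<lambda>c d. f (act _ (S c)) d", symmetric] lin_MS f_lin)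
  also have "\<dots> = tsum (\<rho> m) (\<lambda>a b. tsum (\<rho> a) (\<lambda>c d. f (act c (S d)) (L b)))"
    by (intro tsum_coact_coassoc[of t, symmetric] lin_MS f_lin)
  also have "\<dots> = tsum (\<rho> m) (\<lambda>a b. f (E a) (L b))"
    by (simp only: E_def push)
  finally show ?thesis .
qed

lemma rota_baxter_paired_comodule_E:
  "rota_baxter_paired_comodule scaleH \<Delta> \<epsilon> scaleM \<rho> L E (- 1)"
proof (intro rota_baxter_paired_comodule.intro rota_baxter_paired_comodule_axioms.intro
    right_comodule_axioms)
  show "Vector_Spaces.linear scaleH scaleH L" by (rule linear_L)
  show "Vector_Spaces.linear scaleM scaleM E" by (rule linear_E)
next
  fix m
  note id = M.linear_id linear_id
  note maps = linear_E linear_L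
  \<comment> \<open>A tensor is determined by its contractions only as a member of the tensor space,
    so membership is recorded for each operation occurring in the identity.\<close>
  have map_space: "tensor_map scaleM scaleH f g X \<in> tensor_space scaleM scaleH"
    if "Vector_Spaces.linear scaleM scaleM f" "Vector_Spaces.linear scaleH scaleH g"
      "X \<in> tensor_space scaleM scaleH" for f g X
    using that(3) by (auto simp: tensor_space_def tensor_map_class[OF that(1,2)])
  have add_space: "tensor_add scaleM scaleH X Y \<in> tensor_space scaleM scaleH"
    if "X \<in> tensor_space scaleM scaleH" "Y \<in> tensor_space scaleM scaleH" for X Y
    using that by (auto simp: tensor_space_def tensor_add_class)
  have scale_space: "tensor_scale scaleM scaleH c X \<in> tensor_space scaleM scaleH"
    if "X \<in> tensor_space scaleM scaleH" for c X
    using that by (auto simp: tensor_space_def tensor_scale_class[OF M.vector_space_axioms vector_space_axioms])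
  note spaces = map_space add_space scale_space coact_space maps id
  show "tensor_map scaleM scaleH E L (\<rho> m) =
      tensor_add scaleM scaleH
        (tensor_add scaleM scaleH
          (tensor_map scaleM scaleH id L (\<rho> (E m)))
          (tensor_map scaleM scaleH E id (\<rho> (E m))))
        (tensor_scale scaleM scaleH (- 1) (\<rho> (E m)))"
  proof (rule tensor_eqI)
    fix \<phi> assume phi: "Vector_Spaces.linear scaleM (*) \<phi>"
    let ?f = "\<lambda>x y. scaleH (\<phi> x) y"
    have f: "bilinear_map scaleM scaleH scaleH ?f"
      by (intro lin_M linear_comp[OF phi])
    note maps_f = tsum_tensor_map[OF maps f coact_space]
      tsum_tensor_map[OF M.linear_id linear_L f coact_space]
      tsum_tensor_map[OF linear_E linear_id f coact_space]
    \<comment> \<open>After contraction the first and third terms on the right cancel by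
      \<open>tsum_coact_E_L\<close>, and the middle one is the left-hand side by
      \<open>tsum_coact_E_E\<close>.\<close>
    show "tsum (tensor_map scaleM scaleH E L (\<rho> m)) ?f = tsum (tensor_add scaleM scaleH
        (tensor_add scaleM scaleH
          (tensor_map scaleM scaleH id L (\<rho> (E m)))
          (tensor_map scaleM scaleH E id (\<rho> (E m))))
        (tensor_scale scaleM scaleH (- 1) (\<rho> (E m)))) ?f"
      by (simp add: tsum_tensor_add[OF _ _ f] maps_f tsum_tensor_scale[OF f] spaces
          tsum_coact_E_E[OF f] tsum_coact_E_L[OF f])
  qed (intro M.vector_space_axioms vector_space_axioms spaces)+
qed

end

theorem proposition4p7:
  fixes scaleH :: "'k::field \<Rightarrow> 'h::{ring,monoid_mult} \<Rightarrow> 'h"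
    and \<Delta> :: "'h \<Rightarrow> ('h, 'h) tensor"
    and \<epsilon> :: "'h \<Rightarrow> 'k"
    and S :: "'h \<Rightarrow> 'h"
    and scaleM :: "'k \<Rightarrow> 'm::ab_group_add \<Rightarrow> 'm"
    and act :: "'m \<Rightarrow> 'h \<Rightarrow> 'm"
    and \<rho> :: "'m \<Rightarrow> ('m, 'h) tensor"
    and T :: "'m \<Rightarrow> 'm"
  assumes "weak_hopf_algebra scaleH \<Delta> \<epsilon> S"
    and "quantum_commutative scaleH \<Delta> \<epsilon>"
    and "weak_right_hopf_module scaleH \<Delta> \<epsilon> scaleM act \<rho>"
    and "\<And>m. T m = tensor_lift (\<lambda>m0 m1. act m0 (S m1)) (\<rho> m)"
  shows "rota_baxter_paired_comodule scaleH \<Delta> \<epsilon> scaleM \<rho> (sqcap_L scaleH \<Delta> \<epsilon>) T (- 1)"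
proof -
  interpret weak_hopf_algebra_module scaleH \<Delta> \<epsilon> S scaleM act \<rho>
    using assms(1,3) by (rule weak_hopf_algebra_module.intro)
  \<comment> \<open>The summand \<open>act m0 (S m1)\<close> is bilinear, so
    \<open>tensor_lift\<close> and \<open>tsum\<close> agree on it.\<close>
  have "T = E"
    unfolding E_def fun_eq_iff assms(4)
    by (intro allI tensor_lift_eq_tsum[OF coact_space, where t = scaleM] lin_MS)
  then show ?thesis
    using rota_baxter_paired_comodule_E by simp
qed

end
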